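(* Let $(V,C)$ be a connected braided vector space of diagonal type with $1<\dim V<\infty$. Then the Nichols algebra $\mathfrak B(V)$ is finite-dimensional if and only if the Nichols braided Lie algebra $\mathfrak L(V)$ is finite-dimensional.
   Context: $F$ is a field of characteristic zero. $V$ is a vector space over $F$ with basis $x_1,\dots,x_n$ ($n>1$), with braiding of diagonal type $C(x_i\otimes x_j)=q_{ij}\,x_j\otimes x_i$, $q_{ij}\in F\setminus\{0\}$. $V$ is connected if the graph on $\{1,\dots,n\}$ with an edge between $i\neq j$ exactly when $q_{ij}q_{ji}\neq 1$ is connected. $\mathfrak B(V)$ is the Nichols algebra of $(V,C)$, i.e. the quotient of the tensor algebra $T(V)$ by the sum of the kernels of the quantum symmetrizers; it is $\mathbb N_0^n$-graded with $\deg x_i=e_i$, and "homogeneous" refers to this grading. For homogeneous $u,v$ of degrees $\alpha,\beta$ put $p_{uv}=\prod_{i,j}q_{ij}^{\alpha_i\beta_j}$. The braided bracket on $\mathfrak B(V)$ is the bilinear extension of $[x,y]=yx-p_{yx}xy$ ($x,y$ homogeneous). $\mathfrak L(V)$ is the smallest subspace of $\mathfrak B(V)$ containing $V$ and closed under $[\ ,\ ]$. *)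

theory Defs
  imports
    "HOL-Library.Poly_Mapping"
    "HOL-Combinatorics.Permutations"
    "HOL-Algebra.Embedded_Algebras"
    "HOL-Algebra.QuotRing"
    "HOL-Algebra.Algebraic_Closure_Type"
begin

text \<open>
  Throughout, the basis of \<open>V\<close> is indexed by a finite type \<open>'n\<close>, and the braiding is given by
  \<open>q :: 'n \<Rightarrow> 'n \<Rightarrow> 'a\<close>, meaning \<open>C (x\<^sub>i \<otimes> x\<^sub>j) = q i j \<cdot> x\<^sub>j \<otimes> x\<^sub>i\<close>.
\<close>

section \<open>The tensor algebra\<close>

text \<open>
  Words form the free monoid under concatenation. With this monoid structure the convolution
  product on finitely supported functions \<open>'n list \<Rightarrow>\<^sub>0 'a\<close> makes them the free associative algebra
  on \<open>'n\<close>, that is \<open>T(V)\<close>; the word \<open>[i, j, \<dots>]\<close> stands for \<open>x\<^sub>i \<otimes> x\<^sub>j \<otimes> \<dots>\<close>.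
\<close>

instantiation list :: (type) monoid_add
begin

definition zero_list :: "'a list" where "zero_list = []"

definition plus_list :: "'a list \<Rightarrow> 'a list \<Rightarrow> 'a list" where "plus_list = (@)"

instance by standard (simp_all add: zero_list_def plus_list_def)

end

type_synonym ('n, 'a) tensor = "'n list \<Rightarrow>\<^sub>0 'a"

abbreviation tword :: "'n list \<Rightarrow> ('n, 'a::field_char_0) tensor" where
  "tword w \<equiv> Poly_Mapping.single w 1"

abbreviation tscalar :: "'a::field_char_0 \<Rightarrow> ('n, 'a) tensor" where
  "tscalar c \<equiv> Poly_Mapping.single [] c"

definition linear_extension ::
    "('n list \<Rightarrow> ('n, 'a::field_char_0) tensor) \<Rightarrow> ('n, 'a) tensor \<Rightarrow> ('n, 'a) tensor" where
  "linear_extension h f =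
     (\<Sum>w \<in> Poly_Mapping.keys f. tscalar (Poly_Mapping.lookup f w) * h w)"

definition tensor_power :: "nat \<Rightarrow> ('n, 'a::field_char_0) tensor set" where
  "tensor_power m = {f. \<forall>w \<in> Poly_Mapping.keys f. length w = m}"

section \<open>Quantum symmetrizers\<close>

text \<open>
  \<open>braid q i\<close> is the braiding applied to the tensor factors at positions \<open>i\<close> and \<open>i + 1\<close>
  (counted from 0). It is only used on \<open>tensor_power m\<close> with \<open>i + 1 < m\<close>.
\<close>

definition braid ::
    "('n \<Rightarrow> 'n \<Rightarrow> 'a::field_char_0) \<Rightarrow> nat \<Rightarrow> ('n, 'a) tensor \<Rightarrow> ('n, 'a) tensor" where
  "braid q i = linear_extension
     (\<lambda>w. tscalar (q (w ! i) (w ! Suc i)) * tword (w[i := w ! Suc i, Suc i := w ! i]))"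

text \<open>A list \<open>[i\<^sub>1, \<dots>, i\<^sub>k]\<close> represents the product \<open>s\<^bsub>i\<^sub>1\<^esub> \<circ> \<dots> \<circ> s\<^bsub>i\<^sub>k\<^esub>\<close> of simple transpositions.\<close>

definition simple_product :: "nat list \<Rightarrow> nat \<Rightarrow> nat" where
  "simple_product is = foldr (\<lambda>i p. transpose i (Suc i) \<circ> p) is id"

definition expression_of :: "nat \<Rightarrow> (nat \<Rightarrow> nat) \<Rightarrow> nat list \<Rightarrow> bool" where
  "expression_of m p is \<longleftrightarrow> (\<forall>i \<in> set is. Suc i < m) \<and> simple_product is = p"

definition reduced_expression :: "nat \<Rightarrow> (nat \<Rightarrow> nat) \<Rightarrow> nat list \<Rightarrow> bool" where
  "reduced_expression m p is \<longleftrightarrow>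
     expression_of m p is \<and> (\<forall>js. expression_of m p js \<longrightarrow> length is \<le> length js)"

text \<open>
  The lift \<open>T\<^sub>p = C\<^bsub>i\<^sub>1\<^esub> \<circ> \<dots> \<circ> C\<^bsub>i\<^sub>k\<^esub>\<close> of a permutation along a reduced expression. Since \<open>C\<close> satisfies
  the braid equation, it does not depend on the chosen reduced expression (Matsumoto).
\<close>

definition braid_lift ::
    "('n \<Rightarrow> 'n \<Rightarrow> 'a::field_char_0) \<Rightarrow> nat \<Rightarrow> (nat \<Rightarrow> nat) \<Rightarrow> ('n, 'a) tensor \<Rightarrow> ('n, 'a) tensor" where
  "braid_lift q m p = foldr (\<lambda>i T. braid q i \<circ> T) (SOME is. reduced_expression m p is) id"

definition quantum_symmetrizer ::
    "('n \<Rightarrow> 'n \<Rightarrow> 'a::field_char_0) \<Rightarrow> nat \<Rightarrow> ('n, 'a) tensor \<Rightarrow> ('n, 'a) tensor" where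
  "quantum_symmetrizer q m f = (\<Sum>p | p permutes {..<m}. braid_lift q m p f)"

definition symmetrizer_kernel ::
    "('n \<Rightarrow> 'n \<Rightarrow> 'a::field_char_0) \<Rightarrow> nat \<Rightarrow> ('n, 'a) tensor set" where
  "symmetrizer_kernel q m = {f \<in> tensor_power m. quantum_symmetrizer q m f = 0}"

section \<open>The Nichols algebra\<close>

definition nichols_ideal :: "('n \<Rightarrow> 'n \<Rightarrow> 'a::field_char_0) \<Rightarrow> ('n, 'a) tensor set" where
  "nichols_ideal q = {(\<Sum>m<N. g m) | N g. \<forall>m<N. g m \<in> symmetrizer_kernel q m}"

definition tensor_algebra :: "('n, 'a::field_char_0) tensor ring" where
  "tensor_algebra = ring_of_type_algebra"

definition nichols_algebra :: "('n \<Rightarrow> 'n \<Rightarrow> 'a::field_char_0) \<Rightarrow> ('n, 'a) tensor set ring" where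
  "nichols_algebra q = tensor_algebra Quot nichols_ideal q"

definition nichols_proj ::
    "('n \<Rightarrow> 'n \<Rightarrow> 'a::field_char_0) \<Rightarrow> ('n, 'a) tensor \<Rightarrow> ('n, 'a) tensor set" where
  "nichols_proj q f = nichols_ideal q +>\<^bsub>tensor_algebra\<^esub> f"

text \<open>
  The copy of the ground field inside the Nichols algebra; multiplying by its elements is scalar
  multiplication, so dimensions over the ground field are dimensions over this subfield.
\<close>

definition nichols_scalars :: "('n \<Rightarrow> 'n \<Rightarrow> 'a::field_char_0) \<Rightarrow> ('n, 'a) tensor set set" where
  "nichols_scalars q = range (\<lambda>c. nichols_proj q (tscalar c))"

section \<open>The braided bracket and the Nichols braided Lie algebra\<close>

definition multidegree :: "'n list \<Rightarrow> 'n \<Rightarrow> nat" where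
  "multidegree w i = count_list w i"

definition bicharacter ::
    "('n::finite \<Rightarrow> 'n \<Rightarrow> 'a::field_char_0) \<Rightarrow> ('n \<Rightarrow> nat) \<Rightarrow> ('n \<Rightarrow> nat) \<Rightarrow> 'a" where
  "bicharacter q \<alpha> \<beta> = (\<Prod>i\<in>UNIV. \<Prod>j\<in>UNIV. q i j ^ (\<alpha> i * \<beta> j))"

definition homogeneous :: "('n \<Rightarrow> nat) \<Rightarrow> ('n, 'a::field_char_0) tensor \<Rightarrow> bool" where
  "homogeneous \<alpha> f \<longleftrightarrow> (\<forall>w \<in> Poly_Mapping.keys f. multidegree w = \<alpha>)"

text \<open>
  The bracket on \<open>T(V)\<close>, extended bilinearly from the basis of words, which is homogeneous.
  The lemma \<open>tensor_bracket_homogeneous\<close> below gives the formula for arbitrary homogeneous elements.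
\<close>

definition tensor_bracket ::
    "('n::finite \<Rightarrow> 'n \<Rightarrow> 'a::field_char_0) \<Rightarrow> ('n, 'a) tensor \<Rightarrow> ('n, 'a) tensor \<Rightarrow> ('n, 'a) tensor" where
  "tensor_bracket q f g =
     linear_extension (\<lambda>u. linear_extension (\<lambda>v.
       tword v * tword u
         - tscalar (bicharacter q (multidegree v) (multidegree u)) * (tword u * tword v)) g) f"

text \<open>
  The induced bracket on cosets, built like the product of cosets in \<^const>\<open>rcoset_mult\<close>. All the
  cosets in the union coincide, because the ideal is two-sided and homogeneous.
\<close>

definition nichols_bracket ::
    "('n::finite \<Rightarrow> 'n \<Rightarrow> 'a::field_char_0) \<Rightarrow> ('n, 'a) tensor set \<Rightarrow> ('n, 'a) tensor set
      \<Rightarrow> ('n, 'a) tensor set" where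
  "nichols_bracket q A B = (\<Union>f\<in>A. \<Union>g\<in>B. nichols_proj q (tensor_bracket q f g))"

text \<open>
  The library predicate \<^const>\<open>subalgebra\<close> \<open>K U R\<close> only asks that \<open>U\<close> be a \<open>K\<close>-subspace of \<open>R\<close>,
  with no closure under the product of \<open>R\<close>.
\<close>

definition nichols_lie_algebra ::
    "('n::finite \<Rightarrow> 'n \<Rightarrow> 'a::field_char_0) \<Rightarrow> ('n, 'a) tensor set set" where
  "nichols_lie_algebra q =
     \<Inter>{U. subalgebra (nichols_scalars q) U (nichols_algebra q)
          \<and> nichols_proj q ` tensor_power 1 \<subseteq> U
          \<and> (\<forall>A\<in>U. \<forall>B\<in>U. nichols_bracket q A B \<in> U)}"

section \<open>Connectedness\<close>

definition braiding_graph :: "('n \<Rightarrow> 'n \<Rightarrow> 'a::field_char_0) \<Rightarrow> ('n \<times> 'n) set" where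
  "braiding_graph q = {(i, j). i \<noteq> j \<and> q i j * q j i \<noteq> 1}"

definition connected_braiding :: "('n \<Rightarrow> 'n \<Rightarrow> 'a::field_char_0) \<Rightarrow> bool" where
  "connected_braiding q \<longleftrightarrow> (\<forall>i j. (i, j) \<in> (braiding_graph q)\<^sup>*)"

section \<open>The bracket of homogeneous elements\<close>

lemma linear_extension_tword: "linear_extension tword f = f"
proof (rule poly_mapping_eqI)
  fix w
  have "Poly_Mapping.lookup (linear_extension tword f) w =
        (\<Sum>u\<in>Poly_Mapping.keys f. if u = w then Poly_Mapping.lookup f u else 0)"
    unfolding linear_extension_def
    by (auto simp: lookup_sum mult_single zero_list_def plus_list_def lookup_single when_def
             intro!: sum.cong)
  also have "\<dots> = Poly_Mapping.lookup f w"
    by (simp add: in_keys_iff)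
  finally show "Poly_Mapping.lookup (linear_extension tword f) w = Poly_Mapping.lookup f w" .
qed

lemma tscalar_commute: "tscalar c * f = f * tscalar c"
proof -
  have "tscalar c * linear_extension tword f = linear_extension tword f * tscalar c"
    unfolding linear_extension_def sum_distrib_left sum_distrib_right
    by (intro sum.cong) (simp_all add: mult_single plus_list_def mult.commute)
  thus ?thesis by (simp add: linear_extension_tword)
qed

lemma tensor_bracket_homogeneous:
  assumes f: "homogeneous \<alpha> f" and g: "homogeneous \<beta> g"
  shows "tensor_bracket q f g = g * f - tscalar (bicharacter q \<beta> \<alpha>) * (f * g)"
proof -
  let ?p = "tscalar (bicharacter q \<beta> \<alpha>)"
  let ?a = "\<lambda>u. tscalar (Poly_Mapping.lookup f u)" and ?b = "\<lambda>v. tscalar (Poly_Mapping.lookup g v)"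
  let ?K = "Poly_Mapping.keys f" and ?L = "Poly_Mapping.keys g"
  have term_eq: "?a u * (?b v * (tword v * tword u
        - tscalar (bicharacter q (multidegree v) (multidegree u)) * (tword u * tword v)))
      = (?b v * tword v) * (?a u * tword u) - ?p * ((?a u * tword u) * (?b v * tword v))"
    if u: "u \<in> ?K" and v: "v \<in> ?L" for u v
    using f g u v
    by (simp add: homogeneous_def mult_single plus_list_def right_diff_distrib ac_simps)
  have "tensor_bracket q f g =
      (\<Sum>u\<in>?K. \<Sum>v\<in>?L. (?b v * tword v) * (?a u * tword u)
        - ?p * ((?a u * tword u) * (?b v * tword v)))"
    unfolding tensor_bracket_def linear_extension_def sum_distrib_left
    by (intro sum.cong refl term_eq)
  also have "\<dots> = (\<Sum>v\<in>?L. ?b v * tword v) * (\<Sum>u\<in>?K. ?a u * tword u)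
      - ?p * ((\<Sum>u\<in>?K. ?a u * tword u) * (\<Sum>v\<in>?L. ?b v * tword v))"
    by (simp only: sum_subtractf sum_distrib_left [symmetric] sum_distrib_right [symmetric])
  also have "\<dots> = g * f - ?p * (f * g)"
    using linear_extension_tword[of f] linear_extension_tword[of g]
    by (simp add: linear_extension_def)
  finally show ?thesis .
qed

end

theory Submission
  imports Defs "HOL-Library.Function_Algebras"
begin

text \<open>
  Write \<open>r \<alpha> \<beta> = p\<^bsub>\<alpha>\<beta>\<^esub> p\<^bsub>\<beta>\<alpha>\<^esub>\<close>. If \<open>u\<close> and \<open>y\<close> are homogeneous elements of \<open>\<LL>(V)\<close> with \<open>r \<noteq> 1\<close> at
  their degrees, both \<open>[u, y]\<close> and \<open>[y, u]\<close> together show that \<open>u y\<close> itself lies in \<open>\<LL>(V)\<close>; if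
  \<open>u = [a, b]\<close>, it is enough that \<open>r \<noteq> 1\<close> at \<open>a, y\<close> and at \<open>b, y\<close>. By connectedness and the Jacobi
  identity, \<open>\<LL>(V)\<close> is spanned by iterated brackets \<open>u\<close> for each of which one of the two criteria
  applies to \<open>u\<^sup>k x\<^sub>j\<close> for some \<open>j\<close>, as soon as \<open>p\<^bsub>u u\<^esub> = 1\<close>. So if \<open>\<LL>(V)\<close> is finite-dimensional, then
  \<open>u\<^sup>k x\<^sub>j = 0\<close> for large \<open>k\<close>, and the skew derivation \<open>\<partial>\<^sub>j\<close>, together with the local nilpotency of
  \<open>[-, u]\<close>, gives \<open>u\<^sup>k = 0\<close>. If \<open>p\<^bsub>u u\<^esub> \<noteq> 1\<close>, then \<open>u\<^sup>2\<close> is a multiple of \<open>[u, u]\<close>. Since brackets allow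
  one to reorder products of elements of \<open>\<LL>(V)\<close> up to shorter products, the Nichols algebra is spanned by
  ordered monomials with bounded exponents in finitely many iterated brackets.

  All computations take place in the tensor algebra, modulo the Nichols ideal.
\<close>

section \<open>Linear maps on the tensor algebra\<close>

text \<open>The obstacle is a \<open>u\<close> whose degree has \<open>r = 1\<close> against every
  degree (a radical degree): the first criterion never applies to it. But \<open>r\<close> is
  multiplicative, so if \<open>u = [a, b]\<close> has radical degree, the values of \<open>r\<close>
  at \<open>a, y\<close> and at \<open>b, y\<close> are inverse to each other, and both differ from
  1 as soon as one does. The second criterion then only asks for factors of non-radical degree,
  which is why brackets of two radical monomials must be avoided. The condition that
  \<open>u\<close> has self-braiding 1 gives \<open>r = 1\<close> at \<open>u, u\<close>;
  multiplying by one more \<open>u\<close> therefore leaves the tested value of \<open>r\<close>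
  unchanged, and the step to the next power can be repeated. Finite dimension is translated into
  lengths. The Nichols ideal is graded, so elements of L(V) of large length vanish modulo it;
  conversely, if all long words vanish, finitely many words span the Nichols algebra. That the ideal
  is two-sided and stable under rescalings and skew derivations comes from one recursion: an element
  of length \<open>Suc m\<close> is in the kernel of the symmetrizer iff all its skew derivatives
  are in the kernel for \<open>m\<close>.\<close>

lemma tensor_single_mult: "Poly_Mapping.single u a * Poly_Mapping.single v b = Poly_Mapping.single (u @ v) (a * b)"
  by (simp add: mult_single plus_list_def)

lemma tscalar_one: "tscalar 1 = 1"
  by (metis single_one zero_list_def)

lemma tscalar_add: "tscalar (a + b) = tscalar a + tscalar b"
  by (rule single_add)

lemma tscalar_uminus: "tscalar (- a) = - tscalar a"
  by (simp add: single_uminus)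

lemma tscalar_mult: "tscalar a * tscalar b = tscalar (a * b)"
  by (simp add: tensor_single_mult)

lemma tscalar_mult_assoc: "tscalar a * (tscalar b * f) = tscalar (a * b) * f"
  by (simp add: tscalar_mult flip: mult.assoc)

lemma tscalar_left_commute: "f * (tscalar c * g) = tscalar c * (f * g)"
  by (metis mult.assoc tscalar_commute)

lemma tword_append: "tword (u @ v) = tword u * tword v"
  by (simp add: tensor_single_mult)

lemma tword_Nil: "tword [] = 1"
  by (rule tscalar_one)

lemma single_eq_tscalar_tword: "Poly_Mapping.single w c = tscalar c * tword w"
  by (simp add: tensor_single_mult)

lemma tensor_eq_sum: "f = (\<Sum>w\<in>Poly_Mapping.keys f. Poly_Mapping.single w (Poly_Mapping.lookup f w))"
  for f :: "('n, 'a::field_char_0) tensor"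
  using linear_extension_tword[of f]
  by (simp add: linear_extension_def tensor_single_mult)

text \<open>The \<open>single\<close> case meets only words in the support of the given
  \<open>f\<close>, so that a length bound or another fact about this support is available
  there.\<close>

lemma tensor_induct [case_names zero add single]:
  fixes f :: "('n, 'a::field_char_0) tensor"
  assumes "P 0" "\<And>f g. P f \<Longrightarrow> P g \<Longrightarrow> P (f + g)"
    and "\<And>w c. w \<in> Poly_Mapping.keys f \<Longrightarrow> P (Poly_Mapping.single w c)"
  shows "P f"
proof -
  have "P (\<Sum>w\<in>S. Poly_Mapping.single w (Poly_Mapping.lookup f w))"
    if "finite S" "S \<subseteq> Poly_Mapping.keys f" for S
    using that by (induction S rule: finite_induct) (auto intro: assms)
  from this[of "Poly_Mapping.keys f"] show ?thesis
    using tensor_eq_sum[of f] by simp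
qed

lemma linear_extension_superset:
  assumes "finite S" "Poly_Mapping.keys f \<subseteq> S"
  shows "linear_extension h f = (\<Sum>w\<in>S. tscalar (Poly_Mapping.lookup f w) * h w)"
  unfolding linear_extension_def
  by (rule sum.mono_neutral_left) (use assms in \<open>auto simp: in_keys_iff\<close>)

lemma linear_extension_zero [simp]: "linear_extension h 0 = 0"
  by (simp add: linear_extension_def)

lemma linear_extension_add: "linear_extension h (f + g) = linear_extension h f + linear_extension h g"
proof -
  let ?S = "Poly_Mapping.keys f \<union> Poly_Mapping.keys g"
  have "Poly_Mapping.keys (f + g) \<subseteq> ?S" by (rule keys_add)
  then show ?thesis
    by (simp add: linear_extension_superset[of ?S] lookup_add tscalar_add distrib_right sum.distrib)
qed

lemma linear_extension_single: "linear_extension h (Poly_Mapping.single w c) = tscalar c * h w"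
  by (simp add: linear_extension_superset[of "{w}"])

lemma linear_extension_word: "linear_extension h (tword w) = h w"
  by (simp add: linear_extension_single tscalar_one)

lemma linear_extension_scale: "linear_extension h (tscalar c * f) = tscalar c * linear_extension h f"
  by (induction f rule: tensor_induct)
     (simp_all add: linear_extension_add distrib_left tensor_single_mult linear_extension_single
        tscalar_mult_assoc)

lemma linear_extension_sum: "linear_extension h (sum f S) = (\<Sum>x\<in>S. linear_extension h (f x))"
  by (induction S rule: infinite_finite_induct) (simp_all add: linear_extension_add)

lemma linear_extension_fun_add:
  "linear_extension (\<lambda>w. h w + k w) f = linear_extension h f + linear_extension k f"
  by (simp add: linear_extension_def distrib_left sum.distrib)

lemma linear_extension_fun_diff:
  "linear_extension (\<lambda>w. h w - k w) f = linear_extension h f - linear_extension k f"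
  by (simp add: linear_extension_def right_diff_distrib sum_subtractf)

lemma linear_extension_fun_mult_left:
  "linear_extension (\<lambda>w. g * h w) f = g * linear_extension h f"
  by (simp add: linear_extension_def sum_distrib_left tscalar_left_commute)

lemma linear_extension_fun_mult_right:
  "linear_extension (\<lambda>w. h w * g) f = linear_extension h f * g"
  by (simp add: linear_extension_def sum_distrib_right mult.assoc)

lemma linear_extension_cong:
  assumes "\<And>w. w \<in> Poly_Mapping.keys f \<Longrightarrow> h w = k w"
  shows "linear_extension h f = linear_extension k f"
  unfolding linear_extension_def using assms by (intro sum.cong) auto

section \<open>The grading by length\<close>

lemma tensor_power_zero [simp]: "0 \<in> tensor_power m"
  by (simp add: tensor_power_def)

lemma tensor_power_add: "f \<in> tensor_power m \<Longrightarrow> g \<in> tensor_power m \<Longrightarrow> f + g \<in> tensor_power m"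
  using keys_add[of f g] by (auto simp: tensor_power_def)

lemma tensor_power_single [simp]:
  "Poly_Mapping.single w c \<in> tensor_power m \<longleftrightarrow> c = 0 \<or> length w = m"
  by (auto simp: tensor_power_def)

lemma tensor_power_mult:
  assumes "f \<in> tensor_power m" "g \<in> tensor_power k"
  shows "f * g \<in> tensor_power (m + k)"
  using keys_mult[of f g] assms by (fastforce simp: tensor_power_def plus_list_def)

lemma tensor_power_scale: "f \<in> tensor_power m \<Longrightarrow> tscalar c * f \<in> tensor_power m"
  using tensor_power_mult[of "tscalar c" 0 f m] by simp

lemma tensor_power_sum: "(\<And>x. x \<in> S \<Longrightarrow> f x \<in> tensor_power m) \<Longrightarrow> sum f S \<in> tensor_power m"
  by (induction S rule: infinite_finite_induct) (auto intro: tensor_power_add)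

lemma tensor_power_linear_extension:
  assumes "f \<in> tensor_power m" "\<And>w. length w = m \<Longrightarrow> h w \<in> tensor_power k"
  shows "linear_extension h f \<in> tensor_power k"
  unfolding linear_extension_def using assms
  by (intro tensor_power_sum tensor_power_scale) (auto simp: tensor_power_def)

definition length_part :: "nat \<Rightarrow> ('n, 'a::field_char_0) tensor \<Rightarrow> ('n, 'a) tensor" where
  "length_part m = linear_extension (\<lambda>w. if length w = m then tword w else 0)"

lemma length_part_same: "f \<in> tensor_power m \<Longrightarrow> length_part m f = f"
  using linear_extension_cong[of f "\<lambda>w. if length w = m then tword w else 0" tword]
  by (simp add: length_part_def linear_extension_tword tensor_power_def)

lemma length_part_other: "f \<in> tensor_power k \<Longrightarrow> k \<noteq> m \<Longrightarrow> length_part m f = 0"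
  using linear_extension_cong[of f "\<lambda>w. if length w = m then tword w else 0" "\<lambda>_. 0"]
  by (force simp: length_part_def tensor_power_def linear_extension_def)

lemma length_part_add: "length_part m (f + g) = length_part m f + length_part m g"
  by (simp add: length_part_def linear_extension_add)

lemma length_part_zero [simp]: "length_part m 0 = 0"
  by (simp add: length_part_def)

lemma length_part_scale: "length_part m (tscalar c * f) = tscalar c * length_part m f"
  by (simp add: length_part_def linear_extension_scale)

lemma length_part_sum: "length_part m (sum f S) = (\<Sum>x\<in>S. length_part m (f x))"
  by (simp add: length_part_def linear_extension_sum)

lemma length_part_single:
  "length_part m (Poly_Mapping.single w c) = (if length w = m then Poly_Mapping.single w c else 0)"
  by (simp add: length_part_def linear_extension_single tensor_single_mult)

lemma sum_length_parts:
  assumes "\<And>w. w \<in> Poly_Mapping.keys f \<Longrightarrow> length w < N"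
  shows "(\<Sum>m<N. length_part m f) = f"
proof (induction f rule: tensor_induct)
  case (single w c)
  then have "length w < N" by (rule assms)
  then show ?case by (simp add: length_part_single)
next
  case (add f g)
  then show ?case by (simp add: length_part_add sum.distrib)
qed simp

section \<open>Skew derivations\<close>

text \<open>Each occurrence of \<open>j\<close> in turn is braided past the letters on its right and
  dropped at the end of the word, picking up \<open>q j b\<close> for every letter \<open>b\<close>
  it passes.\<close>

primrec word_deriv :: "('n \<Rightarrow> 'n \<Rightarrow> 'a::field_char_0) \<Rightarrow> 'n \<Rightarrow> 'n list \<Rightarrow> ('n, 'a) tensor" where
  "word_deriv q j [] = 0"
| "word_deriv q j (i # w) =
     (if i = j then Poly_Mapping.single w (prod_list (map (q j) w)) else 0) + tword [i] * word_deriv q j w"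

definition skew_deriv ::
    "('n \<Rightarrow> 'n \<Rightarrow> 'a::field_char_0) \<Rightarrow> 'n \<Rightarrow> ('n, 'a) tensor \<Rightarrow> ('n, 'a) tensor" where
  "skew_deriv q j = linear_extension (word_deriv q j)"

text \<open>The algebra endomorphism that multiplies the letter \<open>i\<close> by
  \<open>t i\<close>. With \<open>t = q j\<close> it is the twist in the Leibniz rule of the skew
  derivation.\<close>

definition scaling :: "('n \<Rightarrow> 'a::field_char_0) \<Rightarrow> ('n, 'a) tensor \<Rightarrow> ('n, 'a) tensor" where
  "scaling t = linear_extension (\<lambda>w. Poly_Mapping.single w (prod_list (map t w)))"

lemma scaling_single:
  "scaling t (Poly_Mapping.single w c) = Poly_Mapping.single w (c * prod_list (map t w))"
  by (simp add: scaling_def linear_extension_single tensor_single_mult)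

lemma scaling_add: "scaling t (f + g) = scaling t f + scaling t g"
  by (simp add: scaling_def linear_extension_add)

lemma scaling_zero [simp]: "scaling t 0 = 0"
  by (simp add: scaling_def)

lemma scaling_mult: "scaling t (f * g) = scaling t f * scaling t g"
proof (induction f rule: tensor_induct)
  case (single u c)
  show ?case
    by (induction g rule: tensor_induct)
       (simp_all add: scaling_single scaling_add distrib_left tensor_single_mult mult_ac)
qed (simp_all add: scaling_add distrib_right)

lemma scaling_in_tensor_power: "f \<in> tensor_power m \<Longrightarrow> scaling t f \<in> tensor_power m"
  unfolding scaling_def by (rule tensor_power_linear_extension) auto

lemma scaling_homogeneous:
  assumes "\<And>w. w \<in> Poly_Mapping.keys f \<Longrightarrow> prod_list (map t w) = c"
  shows "scaling t f = tscalar c * f"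
proof -
  have "scaling t f = linear_extension (\<lambda>w. tscalar c * tword w) f"
    unfolding scaling_def
    by (rule linear_extension_cong) (simp add: assms tensor_single_mult)
  then show ?thesis
    by (simp only: linear_extension_fun_mult_left linear_extension_tword)
qed

lemma skew_deriv_add: "skew_deriv q j (f + g) = skew_deriv q j f + skew_deriv q j g"
  by (simp add: skew_deriv_def linear_extension_add)

lemma skew_deriv_zero [simp]: "skew_deriv q j 0 = 0"
  by (simp add: skew_deriv_def)

lemma skew_deriv_scale: "skew_deriv q j (tscalar c * f) = tscalar c * skew_deriv q j f"
  by (simp add: skew_deriv_def linear_extension_scale)

lemma skew_deriv_single:
  "skew_deriv q j (Poly_Mapping.single w c) = tscalar c * word_deriv q j w"
  by (simp add: skew_deriv_def linear_extension_single)

lemma word_deriv_append: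
  "word_deriv q j (u @ v) = tword u * word_deriv q j v
     + word_deriv q j u * Poly_Mapping.single v (prod_list (map (q j) v))"
proof (induction u)
  case (Cons i u)
  show ?case
    by (simp add: Cons.IH distrib_left distrib_right tensor_single_mult flip: mult.assoc)
qed (simp add: tscalar_one)

text \<open>A letter dropped from \<open>g\<close> does not meet \<open>f\<close>, whereas one
  dropped from \<open>f\<close> has to pass all of \<open>g\<close>; hence the twist.\<close>

lemma skew_deriv_mult:
  "skew_deriv q j (f * g) = f * skew_deriv q j g + skew_deriv q j f * scaling (q j) g"
proof (induction f rule: tensor_induct)
  case (single u c)
  show ?case
  proof (induction g rule: tensor_induct)
    case (single v d)
    have "tscalar (c * d) * (tword u * word_deriv q j v) = Poly_Mapping.single u c * (tscalar d * word_deriv q j v)"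
      by (simp add: tensor_single_mult flip: mult.assoc)
    moreover have "tscalar (c * d) * (word_deriv q j u * Poly_Mapping.single v (prod_list (map (q j) v)))
        = tscalar c * word_deriv q j u * Poly_Mapping.single v (d * prod_list (map (q j) v))"
      by (metis (no_types, lifting) append_Nil mult.assoc tensor_single_mult tscalar_left_commute)
    ultimately show ?case
      by (simp only: tensor_single_mult skew_deriv_single word_deriv_append scaling_single distrib_left)
  qed (simp_all add: skew_deriv_add scaling_add distrib_left)
qed (simp_all add: skew_deriv_add distrib_right)

lemma skew_deriv_letter: "skew_deriv q j (tword [i]) = (if i = j then 1 else 0)"
  by (simp add: skew_deriv_single tscalar_one)

lemma word_deriv_in_tensor_power: "length w = Suc m \<Longrightarrow> word_deriv q j w \<in> tensor_power m"
proof (induction w arbitrary: m)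
  case (Cons i w)
  have "tword [i] * word_deriv q j w \<in> tensor_power m"
  proof (cases m)
    case (Suc k)
    with Cons show ?thesis using tensor_power_mult[of "tword [i]" 1 _ k] by simp
  qed (use Cons in simp)
  then show ?case using Cons.prems by (auto intro!: tensor_power_add)
qed simp

lemma skew_deriv_in_tensor_power:
  "f \<in> tensor_power (Suc m) \<Longrightarrow> skew_deriv q j f \<in> tensor_power m"
  unfolding skew_deriv_def
  by (rule tensor_power_linear_extension) (auto intro: word_deriv_in_tensor_power)

text \<open>The derivative has lost exactly one letter \<open>j\<close>, which accounts for the
  factor \<open>t j\<close>.\<close>

lemma scaling_skew_deriv: "skew_deriv q j (scaling t f) = tscalar (t j) * scaling t (skew_deriv q j f)"
proof (induction f rule: tensor_induct)
  case (single w c)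
  have *: "tscalar (prod_list (map t w)) * word_deriv q j w = tscalar (t j) * scaling t (word_deriv q j w)"
  proof (induction w)
    case (Cons i w)
    have "tscalar (prod_list (map t (i # w))) * (tword [i] * word_deriv q j w)
        = tscalar (t i) * (tword [i] * (tscalar (prod_list (map t w)) * word_deriv q j w))"
      by (simp add: tscalar_left_commute[of "tword [i]"] tscalar_mult_assoc)
    also have "\<dots> = tscalar (t j) * scaling t (tword [i] * word_deriv q j w)"
      by (simp only: Cons.IH scaling_mult scaling_single)
         (simp add: tscalar_left_commute[of "tword [i]"] tscalar_mult_assoc, simp add: tensor_single_mult mult.commute[of "t i"] flip: mult.assoc)
    finally have **: "tscalar (prod_list (map t (i # w))) * (tword [i] * word_deriv q j w)
        = tscalar (t j) * scaling t (tword [i] * word_deriv q j w)" .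
    show ?case
      by (simp only: word_deriv.simps distrib_left scaling_add **)
         (simp add: scaling_single tensor_single_mult mult.commute mult.left_commute)
  qed simp
  have "skew_deriv q j (scaling t (Poly_Mapping.single w c)) = tscalar c * (tscalar (prod_list (map t w)) * word_deriv q j w)"
    by (simp add: scaling_single skew_deriv_single tscalar_mult_assoc)
  also have "\<dots> = tscalar (t j) * (tscalar c * scaling t (word_deriv q j w))"
    by (simp add: * tscalar_mult_assoc mult_ac)
  finally show ?case
    by (simp add: skew_deriv_single scaling_mult scaling_single)
qed (simp_all add: skew_deriv_add scaling_add distrib_left)

text \<open>Indexing by the position \<open>k\<close> of the dropped letter matches the later
  decomposition of permutations by the position that they send to the end.\<close>

lemma word_deriv_eq_sum:
  "word_deriv q j w = (\<Sum>k<length w. if w ! k = j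
     then Poly_Mapping.single (take k w @ drop (Suc k) w) (\<Prod>b\<in>{k<..<length w}. q j (w ! b)) else 0)"
proof (induction w)
  case (Cons i w)
  have 1: "prod_list (map (q j) w) = (\<Prod>b\<in>{0<..<Suc (length w)}. q j ((i # w) ! b))"
    by (subst prod.list_conv_set_nth, rule prod.reindex_bij_witness[of _ "\<lambda>b. b - 1" Suc]) auto
  have 2: "(\<Prod>b\<in>{k<..<length w}. q j (w ! b)) = (\<Prod>b\<in>{Suc k<..<Suc (length w)}. q j ((i # w) ! b))" for k
    by (rule prod.reindex_bij_witness[of _ "\<lambda>b. b - 1" Suc]) auto
  have "word_deriv q j (i # w) = (if i = j then Poly_Mapping.single w (\<Prod>b\<in>{0<..<Suc (length w)}. q j ((i # w) ! b)) else 0)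
      + (\<Sum>k<length w. if w ! k = j then Poly_Mapping.single (i # take k w @ drop (Suc k) w)
           (\<Prod>b\<in>{Suc k<..<Suc (length w)}. q j ((i # w) ! b)) else 0)"
    unfolding word_deriv.simps Cons.IH sum_distrib_left 1 2
    by (intro arg_cong2[of _ _ _ _ "(+)"] refl sum.cong) (simp_all add: tensor_single_mult)
  then show ?case
    by (simp add: sum.lessThan_Suc_shift del: sum.lessThan_Suc cong: if_cong)
qed simp

text \<open>From here on \<open>inv\<close> denotes the inverse of a function, not of a group
  element.\<close>

unbundle no m_inv_syntax

section \<open>Inversions and reduced expressions\<close>

definition inversions :: "nat \<Rightarrow> (nat \<Rightarrow> nat) \<Rightarrow> (nat \<times> nat) set" where
  "inversions m p = {(a, b). a < b \<and> b < m \<and> p b < p a}"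

lemma finite_inversions: "finite (inversions m p)"
  by (rule finite_subset[of _ "{..<m} \<times> {..<m}"]) (auto simp: inversions_def)

lemma inversions_id [simp]: "inversions m id = {}" "inversions m (\<lambda>a. a) = {}"
  by (auto simp: inversions_def)

lemma simple_product_Nil: "simple_product [] = id"
  by (simp add: simple_product_def)

lemma simple_product_Cons:
  "simple_product (i # is) = transpose i (Suc i) \<circ> simple_product is"
  by (simp add: simple_product_def)

lemma simple_product_permutes:
  "\<forall>i\<in>set is. Suc i < m \<Longrightarrow> simple_product is permutes {..<m}"
proof (induction "is")
  case (Cons i "is")
  then show ?case
    unfolding simple_product_Cons by (intro permutes_compose permutes_swap_id) auto
qed (simp add: simple_product_Nil permutes_id del: id_apply)

text \<open>No number lies strictly between \<open>i\<close> and \<open>Suc i\<close>, so exchanging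
  these two values affects the order of no other pair.\<close>

lemma transpose_Suc_less_iff:
  fixes x y :: nat
  assumes "x \<noteq> y" "{x, y} \<noteq> {i, Suc i}"
  shows "transpose i (Suc i) x < transpose i (Suc i) y \<longleftrightarrow> x < y"
  using assms by (auto simp: transpose_def)

text \<open>The transposition exchanges the values \<open>i\<close> and \<open>Suc i\<close>, which
  sit at the positions \<open>inv p i\<close> and \<open>inv p (Suc i)\<close>; only this pair of
  positions changes its order.\<close>

lemma inversions_transpose:
  assumes p: "p permutes {..<m}" and i: "Suc i < m" and less: "inv p i < inv p (Suc i)"
  shows "inversions m (transpose i (Suc i) \<circ> p) = insert (inv p i, inv p (Suc i)) (inversions m p)"
    and "(inv p i, inv p (Suc i)) \<notin> inversions m p"
proof -
  note pi = permutes_inverses[OF p]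
  have lt: "inv p (Suc i) < m"
    using permutes_in_image[OF permutes_inv[OF p], of "Suc i"] i by simp
  show "(inv p i, inv p (Suc i)) \<notin> inversions m p"
    by (simp add: inversions_def pi)
  have "(a, b) \<in> inversions m (transpose i (Suc i) \<circ> p) \<longleftrightarrow>
        (a, b) \<in> insert (inv p i, inv p (Suc i)) (inversions m p)" for a b
  proof (cases "a < b \<and> b < m")
    case True
    then have ne: "p a \<noteq> p b" using pi(2) by (metis less_irrefl)
    show ?thesis
    proof (cases "{p b, p a} = {i, Suc i}")
      case True
      then consider "p a = i" "p b = Suc i" | "p a = Suc i" "p b = i"
        by (auto simp: doubleton_eq_iff)
      then show ?thesis
      proof cases
        case 1
        then have "a = inv p i" "b = inv p (Suc i)" using pi(2) by metis+
        then show ?thesis using \<open>a < b \<and> b < m\<close> 1 by (simp add: inversions_def)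
      next
        case 2
        then have "a = inv p (Suc i)" "b = inv p i" using pi(2) by metis+
        then show ?thesis using \<open>a < b \<and> b < m\<close> less by simp
      qed
    next
      case False
      moreover have "(a, b) \<noteq> (inv p i, inv p (Suc i))"
        using False pi(1) by auto
      ultimately show ?thesis
        using transpose_Suc_less_iff[OF ne[symmetric] False] \<open>a < b \<and> b < m\<close>
        by (auto simp: inversions_def)
    qed
  next
    case False
    then show ?thesis using less lt by (auto simp: inversions_def)
  qed
  then show "inversions m (transpose i (Suc i) \<circ> p) = insert (inv p i, inv p (Suc i)) (inversions m p)"
    by auto
qed

lemma inv_transpose_comp:
  assumes "p permutes {..<m}"
  shows "inv (transpose i (Suc i) \<circ> p) = inv p \<circ> transpose i (Suc i)"
  using assms by (simp add: o_inv_distrib permutes_bij)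

text \<open>The descending case is the ascending one for
  \<open>transpose i (Suc i) \<circ> p\<close>, because the transposition is an involution.\<close>

lemma card_inversions_transpose:
  assumes p: "p permutes {..<m}" and i: "Suc i < m"
  shows "card (inversions m (transpose i (Suc i) \<circ> p)) =
     (if inv p i < inv p (Suc i) then Suc (card (inversions m p)) else card (inversions m p) - 1)"
    and "\<not> inv p i < inv p (Suc i) \<Longrightarrow> card (inversions m p) > 0"
proof -
  let ?p' = "transpose i (Suc i) \<circ> p"
  have p': "?p' permutes {..<m}"
    using p i by (auto intro!: permutes_compose permutes_swap_id)
  have *: "card (inversions m p) = Suc (card (inversions m ?p'))" if "\<not> inv p i < inv p (Suc i)"
  proof -
    have "inv p i \<noteq> inv p (Suc i)"
      using permutes_inverses(1)[OF p] by (metis n_not_Suc_n)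
    then have "inv ?p' i < inv ?p' (Suc i)"
      using that by (simp add: inv_transpose_comp[OF p])
    moreover have "transpose i (Suc i) \<circ> ?p' = p"
      by (simp add: o_assoc)
    ultimately show ?thesis
      using inversions_transpose[OF p' i] by (simp add: finite_inversions del: comp_apply)
  qed
  show "card (inversions m ?p') =
     (if inv p i < inv p (Suc i) then Suc (card (inversions m p)) else card (inversions m p) - 1)"
    using * inversions_transpose[OF p i] by (simp add: finite_inversions)
  show "\<not> inv p i < inv p (Suc i) \<Longrightarrow> card (inversions m p) > 0"
    using * by simp
qed

lemma card_inversions_le_length:
  "\<forall>i\<in>set is. Suc i < m \<Longrightarrow> card (inversions m (simple_product is)) \<le> length is"
proof (induction "is")
  case Nil
  then show ?case by (simp add: simple_product_Nil)
next
  case (Cons i "is")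
  let ?p = "simple_product is"
  have "card (inversions m (transpose i (Suc i) \<circ> ?p)) \<le> length (i # is)"
    using Cons card_inversions_transpose(1)[OF simple_product_permutes[of "is" m], of i]
    by (auto split: if_splits)
  then show ?case by (subst simple_product_Cons)
qed

lemma increasing_permutes_eq_id:
  fixes p :: "nat \<Rightarrow> nat"
  assumes p: "p permutes {..<m}" and inc: "\<And>i. Suc i < m \<Longrightarrow> p i < p (Suc i)"
  shows "p = id"
proof (rule permutes_natset_ge[OF p])
  have "i < m \<Longrightarrow> i \<le> p i" for i
  proof (induction i)
    case (Suc i)
    then show ?case using inc[of i] by simp
  qed simp
  then show "\<forall>i\<in>{..<m}. i \<le> p i" by simp
qed

text \<open>A descent of \<open>inv p\<close> yields a transposition that removes one inversion;
  without descents \<open>inv p\<close> is increasing, hence the identity.\<close>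

lemma expression_of_length_inversions:
  assumes "p permutes {..<m}"
  shows "\<exists>is. expression_of m p is \<and> length is = card (inversions m p)"
  using assms
proof (induction "card (inversions m p)" arbitrary: p rule: less_induct)
  case less
  show ?case
  proof (cases "\<exists>i. Suc i < m \<and> \<not> inv p i < inv p (Suc i)")
    case True
    then obtain i where i: "Suc i < m" "\<not> inv p i < inv p (Suc i)" by blast
    let ?p' = "transpose i (Suc i) \<circ> p"
    have c: "card (inversions m p) = Suc (card (inversions m ?p'))"
      using card_inversions_transpose[OF less.prems i(1)] i(2) by simp
    have p': "?p' permutes {..<m}"
      using less.prems i by (auto intro!: permutes_compose permutes_swap_id)
    from less.hyps[OF _ p'] c obtain "is" where
      "is": "expression_of m ?p' is" "length is = card (inversions m ?p')" by auto
    have "transpose i (Suc i) \<circ> ?p' = p"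
      by (simp add: o_assoc)
    with "is" c i have "expression_of m p (i # is)" "length (i # is) = card (inversions m p)"
      unfolding expression_of_def simple_product_Cons by auto
    then show ?thesis by blast
  next
    case False
    then have "inv p = id"
      using increasing_permutes_eq_id[OF permutes_inv[OF less.prems]] by blast
    then have "p = id"
      using permutes_inv_inv[OF less.prems] by (metis inv_id)
    then have "expression_of m p [] \<and> length [] = card (inversions m p)"
      by (simp add: expression_of_def simple_product_Nil)
    then show ?thesis by blast
  qed
qed

text \<open>Every expression has at least as many letters as \<open>p\<close> has inversions, and
  one attains this bound; so whichever reduced expression is chosen has this length.\<close>

lemma reduced_expression_SOME:
  assumes "p permutes {..<m}"
  defines "is \<equiv> (SOME is. reduced_expression m p is)"
  shows "expression_of m p is" "length is = card (inversions m p)"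
proof -
  obtain js where js: "expression_of m p js" "length js = card (inversions m p)"
    using expression_of_length_inversions[OF assms(1)] by blast
  then have "reduced_expression m p js"
    by (metis card_inversions_le_length expression_of_def reduced_expression_def)
  then have "reduced_expression m p is"
    unfolding is_def by (rule someI)
  with js show "expression_of m p is" "length is = card (inversions m p)"
    using card_inversions_le_length[of "is" m]
    by (auto simp: reduced_expression_def expression_of_def intro!: antisym)
qed

section \<open>Quantum symmetrizers on words\<close>

text \<open>The inverse appears because the letter at position \<open>a\<close> moves to position
  \<open>p a\<close>.\<close>

definition permuted_word :: "nat \<Rightarrow> (nat \<Rightarrow> nat) \<Rightarrow> 'n list \<Rightarrow> 'n list" where
  "permuted_word m p w = map (\<lambda>a. w ! inv p a) [0..<m]"

text \<open>Along a reduced expression two strands cross at most once, and they do so exactly when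
  their positions form an inversion. The factor thus depends on \<open>p\<close> alone, not on the
  chosen expression.\<close>

definition inversion_coeff ::
    "('n \<Rightarrow> 'n \<Rightarrow> 'a::field_char_0) \<Rightarrow> nat \<Rightarrow> (nat \<Rightarrow> nat) \<Rightarrow> 'n list \<Rightarrow> 'a" where
  "inversion_coeff q m p w = (\<Prod>(a, b)\<in>inversions m p. q (w ! a) (w ! b))"

lemma length_permuted_word [simp]: "length (permuted_word m p w) = m"
  by (simp add: permuted_word_def)

lemma braid_single:
  "braid q i (Poly_Mapping.single w c) =
     Poly_Mapping.single (w[i := w ! Suc i, Suc i := w ! i]) (c * q (w ! i) (w ! Suc i))"
  by (simp add: braid_def linear_extension_single tensor_single_mult)

text \<open>The length hypothesis forces each transposition to add an inversion, so each braiding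
  step contributes the factor of one new pair of letters, taken in their original order.\<close>

lemma braid_expression_word:
  assumes "\<forall>i\<in>set is. Suc i < m" "length is = card (inversions m (simple_product is))" "length w = m"
  shows "foldr (\<lambda>i T. braid q i \<circ> T) is id (tword w) =
     Poly_Mapping.single (permuted_word m (simple_product is) w) (inversion_coeff q m (simple_product is) w)"
  using assms
proof (induction "is")
  case Nil
  have "permuted_word m id w = w"
    using Nil by (intro nth_equalityI) (auto simp: permuted_word_def)
  then have "permuted_word m (\<lambda>a. a) w = w" by (simp add: id_def)
  then show ?case by (simp add: inversion_coeff_def simple_product_Nil)
next
  case (Cons i "is")
  let ?p = "simple_product is"
  have p: "?p permutes {..<m}" and i: "Suc i < m"
    using Cons.prems simple_product_permutes[of "is" m] by auto
  have le: "card (inversions m ?p) \<le> length is"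
    using Cons.prems card_inversions_le_length[of "is" m] by simp
  have "Suc (length is) = card (inversions m (transpose i (Suc i) \<circ> ?p))"
    using Cons.prems(2) by (metis length_Cons simple_product_Cons)
  with le have less: "inv ?p i < inv ?p (Suc i)" and len: "length is = card (inversions m ?p)"
    using card_inversions_transpose(1)[OF p i] by (auto split: if_splits)
  let ?v = "permuted_word m ?p w"
  have "?v[i := ?v ! Suc i, Suc i := ?v ! i] = permuted_word m (transpose i (Suc i) \<circ> ?p) w"
    using i by (intro nth_equalityI)
      (auto simp: permuted_word_def inv_transpose_comp[OF p] nth_list_update transpose_def)
  moreover have "inversion_coeff q m (transpose i (Suc i) \<circ> ?p) w
      = inversion_coeff q m ?p w * q (?v ! i) (?v ! Suc i)"
    using i inversions_transpose[OF p i less]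
    by (simp add: inversion_coeff_def finite_inversions permuted_word_def mult.commute)
  moreover have "foldr (\<lambda>i T. braid q i \<circ> T) is id (tword w) =
      Poly_Mapping.single ?v (inversion_coeff q m ?p w)"
    by (rule Cons.IH[OF _ len]) (use Cons.prems(1,3) in auto)
  then have "foldr (\<lambda>i T. braid q i \<circ> T) (i # is) id (tword w) =
      braid q i (Poly_Mapping.single ?v (inversion_coeff q m ?p w))"
    by simp
  ultimately show ?case
    by (simp only: braid_single simple_product_Cons)
qed

lemma braid_lift_word:
  assumes "p permutes {..<m}" "length w = m"
  shows "braid_lift q m p (tword w) = Poly_Mapping.single (permuted_word m p w) (inversion_coeff q m p w)"
  using braid_expression_word[of "SOME is. reduced_expression m p is" m w q] assms(2)
    reduced_expression_SOME[OF assms(1)]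
  by (simp add: braid_lift_def expression_of_def)

lemma quantum_symmetrizer_word:
  assumes "length w = m"
  shows "quantum_symmetrizer q m (tword w) =
    (\<Sum>p | p permutes {..<m}. Poly_Mapping.single (permuted_word m p w) (inversion_coeff q m p w))"
  unfolding quantum_symmetrizer_def using assms
  by (intro sum.cong refl braid_lift_word) auto

lemma foldr_braid_add:
  "foldr (\<lambda>i T. braid q i \<circ> T) is id (f + g) = foldr (\<lambda>i T. braid q i \<circ> T) is id f + foldr (\<lambda>i T. braid q i \<circ> T) is id g"
  by (induction "is") (simp_all add: braid_def linear_extension_add)

lemma foldr_braid_scale:
  "foldr (\<lambda>i T. braid q i \<circ> T) is id (tscalar c * f) = tscalar c * foldr (\<lambda>i T. braid q i \<circ> T) is id f"
  by (induction "is") (simp_all add: braid_def linear_extension_scale)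

lemma quantum_symmetrizer_add:
  "quantum_symmetrizer q m (f + g) = quantum_symmetrizer q m f + quantum_symmetrizer q m g"
  by (simp add: quantum_symmetrizer_def braid_lift_def foldr_braid_add sum.distrib)

lemma quantum_symmetrizer_scale:
  "quantum_symmetrizer q m (tscalar c * f) = tscalar c * quantum_symmetrizer q m f"
  by (simp add: quantum_symmetrizer_def braid_lift_def foldr_braid_scale sum_distrib_left)

lemma quantum_symmetrizer_zero [simp]: "quantum_symmetrizer q m 0 = 0"
  using quantum_symmetrizer_add[of q m 0 0] by simp

lemma quantum_symmetrizer_sum:
  "quantum_symmetrizer q m (sum f S) = (\<Sum>x\<in>S. quantum_symmetrizer q m (f x))"
  by (induction S rule: infinite_finite_induct) (simp_all add: quantum_symmetrizer_add)

section \<open>Splitting off the last letter: representatives of the cosets of \<open>S_m\<close> in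
  \<open>S_(m+1)\<close>\<close>

definition cycle_up :: "nat \<Rightarrow> nat \<Rightarrow> nat \<Rightarrow> nat" where
  "cycle_up k m a = (if a < k then a else if a = k then m else if a \<le> m then a - 1 else a)"

definition cycle_down :: "nat \<Rightarrow> nat \<Rightarrow> nat \<Rightarrow> nat" where
  "cycle_down k m a = (if a < k then a else if a < m then Suc a else if a = m then k else a)"

lemma cycle_up_down: "k \<le> m \<Longrightarrow> cycle_up k m (cycle_down k m a) = a"
  by (auto simp: cycle_up_def cycle_down_def)

lemma cycle_down_up: "k \<le> m \<Longrightarrow> cycle_down k m (cycle_up k m a) = a"
  by (auto simp: cycle_up_def cycle_down_def)

lemma cycle_up_permutes: "k \<le> m \<Longrightarrow> cycle_up k m permutes {..<Suc m}"
  by (rule bij_imp_permutes, rule bij_betw_byWitness[where f' = "cycle_down k m"])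
     (auto simp: cycle_up_down cycle_down_up, auto simp: cycle_up_def cycle_down_def)

lemma inv_cycle_up: "k \<le> m \<Longrightarrow> inv (cycle_up k m) = cycle_down k m"
  by (rule inv_equality) (simp_all add: cycle_up_down cycle_down_up)

lemma inv_comp_cycle_up:
  assumes "k \<le> m" "p permutes {..<m}"
  shows "inv (p \<circ> cycle_up k m) = cycle_down k m \<circ> inv p"
  using assms by (simp add: o_inv_distrib permutes_bij[OF cycle_up_permutes] permutes_bij inv_cycle_up)

definition delete_nth :: "nat \<Rightarrow> 'n list \<Rightarrow> 'n list" where
  "delete_nth k w = take k w @ drop (Suc k) w"

lemma length_delete_nth [simp]: "k < length w \<Longrightarrow> length (delete_nth k w) = length w - 1"
  by (simp add: delete_nth_def)

lemma delete_nth_nth: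
  assumes "length w = Suc m" "k \<le> m" "a < m"
  shows "delete_nth k w ! a = w ! cycle_down k m a"
  using assms by (auto simp: delete_nth_def cycle_down_def nth_append min_def)

lemma permuted_word_cycle:
  assumes w: "length w = Suc m" and k: "k \<le> m" and p: "p permutes {..<m}"
  shows "permuted_word (Suc m) (p \<circ> cycle_up k m) w = permuted_word m p (delete_nth k w) @ [w ! k]"
proof -
  have "inv p m = m"
    using permutes_not_in[OF permutes_inv[OF p], of m] by simp
  moreover have "inv p a < m" if "a < m" for a
    using permutes_in_image[OF permutes_inv[OF p], of a] that by simp
  ultimately show ?thesis
    using assms by (simp add: permuted_word_def inv_comp_cycle_up delete_nth_nth) (simp add: cycle_down_def)
qed

text \<open>Position \<open>k\<close> receives the largest value \<open>m\<close>, so it is inverted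
  with every later position and with no earlier one. The remaining inversions are those of
  \<open>p\<close>, renumbered so as to skip \<open>k\<close>.\<close>

lemma inversions_cycle:
  assumes k: "k \<le> m" and p: "p permutes {..<m}"
  shows "inversions (Suc m) (p \<circ> cycle_up k m)
    = {k} \<times> {k<..m} \<union> map_prod (cycle_down k m) (cycle_down k m) ` inversions m p"
proof -
  have pm: "p m = m" using permutes_not_in[OF p] by simp
  have lt: "p a < m" if "a < m" for a
    using permutes_in_image[OF p, of a] that by simp
  have 1: "(a, b) \<in> inversions (Suc m) (p \<circ> cycle_up k m)
     \<longleftrightarrow> (cycle_up k m a, cycle_up k m b) \<in> inversions m p" if "a \<noteq> k" "b \<noteq> k" for a b
    using that k by (auto simp: inversions_def cycle_up_def)
  have 2: "(k, b) \<in> inversions (Suc m) (p \<circ> cycle_up k m) \<longleftrightarrow> b \<in> {k<..m}" for b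
    using k lt by (auto simp: inversions_def cycle_up_def pm)
  have 3: "(a, k) \<notin> inversions (Suc m) (p \<circ> cycle_up k m)" for a
  proof
    assume *: "(a, k) \<in> inversions (Suc m) (p \<circ> cycle_up k m)"
    then have "a < m" using k by (auto simp: inversions_def)
    with * lt[of a] show False by (auto simp: inversions_def cycle_up_def pm)
  qed
  have 4: "(a, b) \<in> map_prod (cycle_down k m) (cycle_down k m) ` inversions m p
      \<longleftrightarrow> (cycle_up k m a, cycle_up k m b) \<in> inversions m p" for a b
    by (force simp: cycle_up_down[OF k] cycle_down_up[OF k] intro!: image_eqI[of _ _ "(cycle_up k m a, cycle_up k m b)"])
  have 5: "(cycle_up k m k, b) \<notin> inversions m p" "(b, cycle_up k m k) \<notin> inversions m p" for b
    by (auto simp: cycle_up_def inversions_def)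
  have "(a, b) \<in> inversions (Suc m) (p \<circ> cycle_up k m) \<longleftrightarrow>
    (a, b) \<in> {k} \<times> {k<..m} \<union> map_prod (cycle_down k m) (cycle_down k m) ` inversions m p" for a b
    using 1[of a b] 2[of b] 3[of a] 4[of a b] 5[of "cycle_up k m a"] 5[of "cycle_up k m b"]
    by (cases "a = k"; cases "b = k") auto
  then show ?thesis by auto
qed

lemma inversion_coeff_cycle:
  assumes w: "length w = Suc m" and k: "k \<le> m" and p: "p permutes {..<m}"
  shows "inversion_coeff q (Suc m) (p \<circ> cycle_up k m) w
    = (\<Prod>b\<in>{k<..<length w}. q (w ! k) (w ! b)) * inversion_coeff q m p (delete_nth k w)"
proof -
  let ?d = "map_prod (cycle_down k m) (cycle_down k m)"
  have inj: "inj_on ?d (inversions m p)"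
    by (rule inj_on_inverseI[where g = "map_prod (cycle_up k m) (cycle_up k m)"])
       (auto simp: cycle_up_down[OF k])
  have disj: "({k} \<times> {k<..m}) \<inter> ?d ` inversions m p = {}"
    using k by (auto simp: inversions_def cycle_down_def split: if_splits)
  have "inversion_coeff q (Suc m) (p \<circ> cycle_up k m) w
     = (\<Prod>(a, b)\<in>{k} \<times> {k<..m}. q (w ! a) (w ! b)) * (\<Prod>(a, b)\<in>?d ` inversions m p. q (w ! a) (w ! b))"
    unfolding inversion_coeff_def inversions_cycle[OF k p]
    by (rule prod.union_disjoint) (auto simp: disj finite_inversions)
  also have "(\<Prod>(a, b)\<in>{k} \<times> {k<..m}. q (w ! a) (w ! b)) = (\<Prod>b\<in>{k<..<length w}. q (w ! k) (w ! b))"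
    unfolding prod.cartesian_product[symmetric]
    by (simp add: w) (rule prod.cong, auto)
  also have "(\<Prod>(a, b)\<in>?d ` inversions m p. q (w ! a) (w ! b)) = inversion_coeff q m p (delete_nth k w)"
    unfolding prod.reindex[OF inj] inversion_coeff_def using k w
    by (intro prod.cong) (auto simp: inversions_def delete_nth_nth)
  finally show ?thesis .
qed

text \<open>The index \<open>k\<close> is the position sent to \<open>m\<close>; undoing the cycle
  leaves a permutation that fixes \<open>m\<close>.\<close>

lemma sum_permutations_Suc:
  "(\<Sum>p | p permutes {..<Suc m}. h p) =
     (\<Sum>k<Suc m. \<Sum>p | p permutes {..<m}. h (p \<circ> cycle_up k m))"
proof -
  have "(\<Sum>(k, p)\<in>{..<Suc m} \<times> {p. p permutes {..<m}}. h (p \<circ> cycle_up k m))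
      = (\<Sum>p | p permutes {..<Suc m}. h p)"
  proof (rule sum.reindex_bij_witness[where j = "\<lambda>(k, p). p \<circ> cycle_up k m"
        and i = "\<lambda>p. (inv p m, p \<circ> cycle_down (inv p m) m)"], goal_cases)
    case (1 x)
    then obtain k p where x: "x = (k, p)" "k \<le> m" "p permutes {..<m}" by auto
    moreover have "inv p m = m"
      using permutes_not_in[OF permutes_inv[OF x(3)], of m] by simp
    ultimately have "inv (p \<circ> cycle_up k m) m = k"
      by (simp add: inv_comp_cycle_up) (simp add: cycle_down_def)
    with x show ?case by (auto simp: fun_eq_iff cycle_up_down)
  next
    case (2 x)
    then obtain k p where x: "x = (k, p)" "k \<le> m" "p permutes {..<m}" by auto
    then have "p permutes {..<Suc m}"
      by (auto intro: permutes_subset)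
    with x show ?case by (auto intro: permutes_compose cycle_up_permutes)
  next
    case (3 p)
    then have "inv p m < Suc m"
      using permutes_in_image[OF permutes_inv[of p], of "{..<Suc m}" m] by simp
    then show ?case by (auto simp: fun_eq_iff cycle_down_up)
  next
    case (4 p)
    then have p: "p permutes {..<Suc m}" by simp
    then have le: "inv p m \<le> m"
      using permutes_in_image[OF permutes_inv[of p], of "{..<Suc m}" m] by simp
    have "cycle_down (inv p m) m permutes {..<Suc m}"
      using permutes_inv[OF cycle_up_permutes[OF le]] inv_cycle_up[OF le] by simp
    with p have "p \<circ> cycle_down (inv p m) m permutes {..<Suc m}"
      by (intro permutes_compose)
    then have "p \<circ> cycle_down (inv p m) m permutes {..<m}"
    proof (rule permutes_superset)
      fix a assume "a \<in> {..<Suc m} - {..<m}"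
      then have "a = m" by auto
      moreover have "cycle_down (inv p m) m m = inv p m"
        using le by (simp add: cycle_down_def)
      ultimately show "(p \<circ> cycle_down (inv p m) m) a = a"
        using permutes_inverses(1)[OF p] by simp
    qed
    with le show ?case by auto
  qed auto
  then show ?thesis
    by (simp add: sum.cartesian_product)
qed

text \<open>The letter sent to the last place is the one dropped by the derivative. The inversions
  at its position give the coefficient of the derivative, the other ones give the symmetrizer of the
  shortened word.\<close>

lemma quantum_symmetrizer_Suc:
  fixes f :: "('n::finite, 'a::field_char_0) tensor"
  assumes "f \<in> tensor_power (Suc m)"
  shows "quantum_symmetrizer q (Suc m) f =
    (\<Sum>j\<in>UNIV. quantum_symmetrizer q m (skew_deriv q j f) * tword [j])"
proof -
  have *: "quantum_symmetrizer q (Suc m) (tword w) =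
    (\<Sum>j\<in>UNIV. quantum_symmetrizer q m (skew_deriv q j (tword w)) * tword [j])"
    if w: "length w = Suc m" for w
  proof -
    let ?c = "\<lambda>k. \<Prod>b\<in>{k<..<length w}. q (w ! k) (w ! b)"
    let ?t = "\<lambda>k. quantum_symmetrizer q m (Poly_Mapping.single (delete_nth k w) (?c k)) * tword [w ! k]"
    have "quantum_symmetrizer q (Suc m) (tword w) = (\<Sum>k<Suc m. \<Sum>p | p permutes {..<m}.
        Poly_Mapping.single (permuted_word m p (delete_nth k w) @ [w ! k])
          (?c k * inversion_coeff q m p (delete_nth k w)))"
      unfolding quantum_symmetrizer_word[OF w] sum_permutations_Suc
      using w by (intro sum.cong refl) (simp add: permuted_word_cycle inversion_coeff_cycle)
    also have "\<dots> = (\<Sum>k<Suc m. ?t k)"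
    proof (intro sum.cong refl)
      fix k assume "k \<in> {..<Suc m}"
      then have "length (delete_nth k w) = m" using w by simp
      then show "(\<Sum>p | p permutes {..<m}. Poly_Mapping.single (permuted_word m p (delete_nth k w) @ [w ! k])
          (?c k * inversion_coeff q m p (delete_nth k w))) = ?t k"
        unfolding single_eq_tscalar_tword[of "delete_nth k w" "?c k"] quantum_symmetrizer_scale
        by (simp add: quantum_symmetrizer_word sum_distrib_left sum_distrib_right tensor_single_mult)
    qed
    also have "\<dots> = (\<Sum>k<Suc m. \<Sum>j\<in>UNIV. if w ! k = j then ?t k else 0)"
      by simp
    also have "\<dots> = (\<Sum>j\<in>UNIV. \<Sum>k<Suc m. if w ! k = j then ?t k else 0)"
      by (rule sum.swap)
    also have "\<dots> = (\<Sum>j\<in>UNIV. quantum_symmetrizer q m (skew_deriv q j (tword w)) * tword [j])"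
      unfolding skew_deriv_def linear_extension_word word_deriv_eq_sum quantum_symmetrizer_sum sum_distrib_right w
      by (intro sum.cong refl) (simp add: delete_nth_def)
    finally show ?thesis .
  qed
  let ?R = "\<lambda>f. \<Sum>j\<in>UNIV. quantum_symmetrizer q m (skew_deriv q j f) * tword [j]"
  show ?thesis
  proof (induction f rule: tensor_induct)
    case (add f g)
    then show ?case
      by (simp add: quantum_symmetrizer_add skew_deriv_add distrib_right sum.distrib)
  next
    case (single w c)
    then have "length w = Suc m" using assms by (auto simp: tensor_power_def)
    then have "quantum_symmetrizer q (Suc m) (tscalar c * tword w) = ?R (tscalar c * tword w)"
      by (simp only: quantum_symmetrizer_scale skew_deriv_scale * sum_distrib_left mult.assoc)
    then show ?case
      by (simp add: tensor_single_mult)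
  qed simp
qed

text \<open>Multidegrees are functions; keeping their sums folded lets rules such as
  \<open>bicharacter_add_left\<close> apply.\<close>

declare plus_fun_apply [simp del] zero_fun_apply [simp del]

section \<open>The Nichols ideal\<close>

lemma tensor_power_0: "f \<in> tensor_power 0 \<Longrightarrow> f = tscalar (Poly_Mapping.lookup f [])"
proof (rule poly_mapping_eqI)
  fix w assume "f \<in> tensor_power 0"
  then have "w \<notin> Poly_Mapping.keys f" if "w \<noteq> []"
    using that by (auto simp: tensor_power_def)
  then show "Poly_Mapping.lookup f w = Poly_Mapping.lookup (tscalar (Poly_Mapping.lookup f [])) w"
    by (cases "w = []") (auto simp: lookup_single in_keys_iff)
qed

lemma symmetrizer_kernel_0: "symmetrizer_kernel q 0 = {0}"
proof -
  have *: "quantum_symmetrizer q 0 (tword []) = tword []"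
    by (subst quantum_symmetrizer_word) (auto simp: permuted_word_def inversion_coeff_def inversions_def)
  have "quantum_symmetrizer q 0 f = f" if f: "f \<in> tensor_power 0" for f
  proof -
    obtain c where "f = tscalar c" using tensor_power_0[OF f] by blast
    then show ?thesis
      using quantum_symmetrizer_scale[of q 0 c "tword []"] by (simp add: * tensor_single_mult)
  qed
  then show ?thesis by (auto simp: symmetrizer_kernel_def)
qed

lemma lookup_mult_letter:
  "Poly_Mapping.lookup (f * tword [j]) (w @ [i]) = (if i = j then Poly_Mapping.lookup f w else 0)"
  by (induction f rule: tensor_induct)
     (auto simp: distrib_right lookup_add tensor_single_mult lookup_single when_def)

text \<open>The summands of \<open>quantum_symmetrizer_Suc\<close> end in different letters, so the
  sum vanishes only if each summand does. Facts about the kernels now follow by induction on the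
  length.\<close>

lemma symmetrizer_kernel_Suc:
  fixes q :: "'n::finite \<Rightarrow> 'n \<Rightarrow> 'a::field_char_0"
  shows "f \<in> symmetrizer_kernel q (Suc m) \<longleftrightarrow>
     f \<in> tensor_power (Suc m) \<and> (\<forall>j. skew_deriv q j f \<in> symmetrizer_kernel q m)"
proof -
  have "(\<Sum>j\<in>UNIV. h j * tword [j]) = 0 \<longleftrightarrow> (\<forall>j. h j = 0)" for h :: "'n \<Rightarrow> ('n, 'a) tensor"
  proof
    assume *: "(\<Sum>j\<in>UNIV. h j * tword [j]) = 0"
    show "\<forall>j. h j = 0"
    proof
      fix j
      have "Poly_Mapping.lookup (h j) w = Poly_Mapping.lookup (\<Sum>j\<in>UNIV. h j * tword [j]) (w @ [j])" for w
        unfolding lookup_sum lookup_mult_letter by simp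
      with * show "h j = 0" by (simp add: poly_mapping_eqI)
    qed
  qed simp
  then show ?thesis
    using skew_deriv_in_tensor_power
    by (auto simp: symmetrizer_kernel_def quantum_symmetrizer_Suc)
qed

lemma symmetrizer_kernel_zero [simp]: "0 \<in> symmetrizer_kernel q m"
  by (simp add: symmetrizer_kernel_def)

lemma symmetrizer_kernel_add:
  "f \<in> symmetrizer_kernel q m \<Longrightarrow> g \<in> symmetrizer_kernel q m \<Longrightarrow> f + g \<in> symmetrizer_kernel q m"
  by (simp add: symmetrizer_kernel_def tensor_power_add quantum_symmetrizer_add)

lemma symmetrizer_kernel_scale:
  "f \<in> symmetrizer_kernel q m \<Longrightarrow> tscalar c * f \<in> symmetrizer_kernel q m"
  by (simp add: symmetrizer_kernel_def tensor_power_scale quantum_symmetrizer_scale)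

lemma symmetrizer_kernel_scaling:
  fixes q :: "'n::finite \<Rightarrow> 'n \<Rightarrow> 'a::field_char_0"
  shows "f \<in> symmetrizer_kernel q m \<Longrightarrow> scaling t f \<in> symmetrizer_kernel q m"
  by (induction m arbitrary: f)
     (auto simp: symmetrizer_kernel_0 symmetrizer_kernel_Suc scaling_skew_deriv
        intro: scaling_in_tensor_power symmetrizer_kernel_scale)

text \<open>By the Leibniz rule each derivative of the product combines a product of the same kind,
  with a derivative of \<open>f\<close> in place of \<open>f\<close>, and possibly \<open>f\<close>
  or a rescaling of it. In length 0 the kernel is zero.\<close>

lemma symmetrizer_kernel_mult_letter:
  fixes q :: "'n::finite \<Rightarrow> 'n \<Rightarrow> 'a::field_char_0"
  assumes "f \<in> symmetrizer_kernel q m"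
  shows "f * tword [i] \<in> symmetrizer_kernel q (Suc m)" and "tword [i] * f \<in> symmetrizer_kernel q (Suc m)"
proof -
  have f: "f \<in> tensor_power m" using assms by (simp add: symmetrizer_kernel_def)
  show "f * tword [i] \<in> symmetrizer_kernel q (Suc m)"
    using assms
  proof (induction m arbitrary: f)
    case (Suc m)
    have "skew_deriv q j (f * tword [i]) \<in> symmetrizer_kernel q (Suc m)" for j
    proof -
      have "skew_deriv q j (f * tword [i]) = f * (if i = j then 1 else 0) + tscalar (q j i) * (skew_deriv q j f * tword [i])"
        by (simp add: skew_deriv_mult skew_deriv_letter scaling_single
            single_eq_tscalar_tword[of "[i]" "q j i"] tscalar_left_commute[of "skew_deriv q j f"])
      moreover have "skew_deriv q j f * tword [i] \<in> symmetrizer_kernel q (Suc m)"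
        using Suc symmetrizer_kernel_Suc by blast
      ultimately show ?thesis
        using Suc.prems by (auto intro!: symmetrizer_kernel_add symmetrizer_kernel_scale)
    qed
    moreover have "f * tword [i] \<in> tensor_power (Suc (Suc m))"
      using tensor_power_mult[of f "Suc m" "tword [i]" 1] Suc.prems by (simp add: symmetrizer_kernel_def)
    ultimately show ?case by (subst symmetrizer_kernel_Suc) auto
  qed (simp add: symmetrizer_kernel_0)
  show "tword [i] * f \<in> symmetrizer_kernel q (Suc m)"
    using assms
  proof (induction m arbitrary: f)
    case (Suc m)
    have "skew_deriv q j (tword [i] * f) \<in> symmetrizer_kernel q (Suc m)" for j
    proof -
      have "skew_deriv q j (tword [i] * f) = tword [i] * skew_deriv q j f + (if i = j then scaling (q j) f else 0)"
        by (simp add: skew_deriv_mult skew_deriv_letter)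
      moreover have "tword [i] * skew_deriv q j f \<in> symmetrizer_kernel q (Suc m)"
        using Suc symmetrizer_kernel_Suc by blast
      ultimately show ?thesis
        using Suc.prems by (auto intro!: symmetrizer_kernel_add symmetrizer_kernel_scaling)
    qed
    moreover have "tword [i] * f \<in> tensor_power (Suc (Suc m))"
      using tensor_power_mult[of "tword [i]" 1 f "Suc m"] Suc.prems by (simp add: symmetrizer_kernel_def)
    ultimately show ?case by (subst symmetrizer_kernel_Suc) auto
  qed (simp add: symmetrizer_kernel_0)
qed

lemma symmetrizer_kernel_mult_word:
  fixes q :: "'n::finite \<Rightarrow> 'n \<Rightarrow> 'a::field_char_0"
  assumes "f \<in> symmetrizer_kernel q m"
  shows "f * tword w \<in> symmetrizer_kernel q (m + length w)" "tword w * f \<in> symmetrizer_kernel q (m + length w)"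
proof -
  show "f * tword w \<in> symmetrizer_kernel q (m + length w)"
  proof (induction w rule: rev_induct)
    case (snoc i w)
    then have "f * tword w * tword [i] \<in> symmetrizer_kernel q (Suc (m + length w))"
      by (rule symmetrizer_kernel_mult_letter)
    then show ?case by (simp add: mult.assoc tensor_single_mult)
  qed (simp add: assms tscalar_one)
  show "tword w * f \<in> symmetrizer_kernel q (m + length w)"
  proof (induction w)
    case (Cons i w)
    then have "tword [i] * (tword w * f) \<in> symmetrizer_kernel q (Suc (m + length w))"
      by (rule symmetrizer_kernel_mult_letter)
    then show ?case by (simp add: tensor_single_mult flip: mult.assoc)
  qed (simp add: assms tscalar_one)
qed

text \<open>The kernels sit in different lengths, so membership can be tested one length at a
  time.\<close>

lemma nichols_ideal_iff: "f \<in> nichols_ideal q \<longleftrightarrow> (\<forall>m. length_part m f \<in> symmetrizer_kernel q m)"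
proof
  assume "f \<in> nichols_ideal q"
  then obtain N g where f: "f = (\<Sum>m<N. g m)" "\<And>m. m < N \<Longrightarrow> g m \<in> symmetrizer_kernel q m"
    by (auto simp: nichols_ideal_def)
  then have g: "g m \<in> tensor_power m" if "m < N" for m
    using that by (simp add: symmetrizer_kernel_def)
  show "\<forall>m. length_part m f \<in> symmetrizer_kernel q m"
  proof
    fix k
    have "length_part k f = (\<Sum>m<N. if m = k then g m else 0)"
      unfolding f(1) length_part_sum
      by (intro sum.cong) (auto intro: length_part_same[OF g] length_part_other[OF g])
    then show "length_part k f \<in> symmetrizer_kernel q k"
      using f(2) by simp
  qed
next
  assume *: "\<forall>m. length_part m f \<in> symmetrizer_kernel q m"
  define N where "N = Suc (Max (length ` Poly_Mapping.keys f))"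
  have "length w < N" if "w \<in> Poly_Mapping.keys f" for w
    using that by (simp add: N_def less_Suc_eq_le)
  then have "f = (\<Sum>m<N. length_part m f)"
    using sum_length_parts[of f N] by simp
  with * show "f \<in> nichols_ideal q"
    unfolding nichols_ideal_def by blast
qed

lemma nichols_ideal_zero [simp]: "0 \<in> nichols_ideal q"
  by (simp add: nichols_ideal_iff)

lemma nichols_ideal_add: "f \<in> nichols_ideal q \<Longrightarrow> g \<in> nichols_ideal q \<Longrightarrow> f + g \<in> nichols_ideal q"
  by (simp add: nichols_ideal_iff length_part_add symmetrizer_kernel_add)

lemma nichols_ideal_scale: "f \<in> nichols_ideal q \<Longrightarrow> tscalar c * f \<in> nichols_ideal q"
  by (simp add: nichols_ideal_iff length_part_scale symmetrizer_kernel_scale)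

lemma nichols_ideal_uminus: "f \<in> nichols_ideal q \<Longrightarrow> - f \<in> nichols_ideal q"
  using nichols_ideal_scale[of f q "-1"] by (simp add: tscalar_uminus tscalar_one)

lemma nichols_ideal_diff: "f \<in> nichols_ideal q \<Longrightarrow> g \<in> nichols_ideal q \<Longrightarrow> f - g \<in> nichols_ideal q"
  using nichols_ideal_add[of f q "- g"] nichols_ideal_uminus by force

lemma symmetrizer_kernel_in_nichols_ideal:
  assumes "f \<in> symmetrizer_kernel q m"
  shows "f \<in> nichols_ideal q"
proof -
  have "f \<in> tensor_power m" using assms by (simp add: symmetrizer_kernel_def)
  then have "length_part k f = (if k = m then f else 0)" for k
    using length_part_same[of f m] length_part_other[of f m] by auto
  with assms show ?thesis by (simp add: nichols_ideal_iff)
qed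

lemma nichols_ideal_induct [consumes 1, case_names zero add kernel]:
  assumes "f \<in> nichols_ideal q" "P 0" "\<And>f g. P f \<Longrightarrow> P g \<Longrightarrow> P (f + g)"
    "\<And>f m. f \<in> symmetrizer_kernel q m \<Longrightarrow> P f"
  shows "P f"
proof -
  obtain N g where f: "f = (\<Sum>m<N. g m)" "\<And>m. m < N \<Longrightarrow> g m \<in> symmetrizer_kernel q m"
    using assms(1) by (auto simp: nichols_ideal_def)
  have "P (\<Sum>m<k. g m)" if "k \<le> N" for k
    using that
  proof (induction k)
    case (Suc k)
    then show ?case using assms(3) assms(4)[OF f(2), of k] by simp
  qed (simp add: assms(2))
  then show ?thesis using f(1) by blast
qed

lemma nichols_ideal_mult:
  fixes q :: "'n::finite \<Rightarrow> 'n \<Rightarrow> 'a::field_char_0"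
  assumes "f \<in> nichols_ideal q"
  shows "f * g \<in> nichols_ideal q" and "g * f \<in> nichols_ideal q"
proof -
  have "f * tword w \<in> nichols_ideal q \<and> tword w * f \<in> nichols_ideal q" for w
    using assms
  proof (induction f rule: nichols_ideal_induct)
    case (kernel f m)
    then show ?case
      using symmetrizer_kernel_mult_word symmetrizer_kernel_in_nichols_ideal by blast
  qed (simp_all add: distrib_left distrib_right nichols_ideal_add)
  then have w: "f * tword w \<in> nichols_ideal q" "tword w * f \<in> nichols_ideal q" for w
    by blast+
  show "f * g \<in> nichols_ideal q"
  proof (induction g rule: tensor_induct)
    case (single w c)
    then show ?case
      using nichols_ideal_scale[OF w(1)[of w], of c]
      by (simp add: single_eq_tscalar_tword[of w c] tscalar_left_commute[of f])
  qed (simp_all add: distrib_left nichols_ideal_add)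
  show "g * f \<in> nichols_ideal q"
  proof (induction g rule: tensor_induct)
    case (single w c)
    then show ?case
      using nichols_ideal_scale[OF w(2)[of w], of c]
      by (simp add: single_eq_tscalar_tword[of w c] mult.assoc)
  qed (simp_all add: distrib_right nichols_ideal_add)
qed

lemma nichols_ideal_scaling:
  fixes q :: "'n::finite \<Rightarrow> 'n \<Rightarrow> 'a::field_char_0"
  assumes "f \<in> nichols_ideal q"
  shows "scaling t f \<in> nichols_ideal q"
  using assms
proof (induction f rule: nichols_ideal_induct)
  case (kernel f m)
  then show ?case
    using symmetrizer_kernel_scaling symmetrizer_kernel_in_nichols_ideal by blast
qed (simp_all add: scaling_add nichols_ideal_add)

lemma nichols_ideal_skew_deriv:
  fixes q :: "'n::finite \<Rightarrow> 'n \<Rightarrow> 'a::field_char_0"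
  assumes "f \<in> nichols_ideal q"
  shows "skew_deriv q j f \<in> nichols_ideal q"
  using assms
proof (induction f rule: nichols_ideal_induct)
  case (kernel f m)
  then show ?case
    by (cases m)
       (auto simp: symmetrizer_kernel_0 symmetrizer_kernel_Suc intro: symmetrizer_kernel_in_nichols_ideal)
qed (simp_all add: skew_deriv_add nichols_ideal_add)

lemma one_notin_nichols_ideal: "1 \<notin> nichols_ideal q"
proof -
  have "length_part 0 (tword []) \<notin> symmetrizer_kernel q 0"
    by (simp add: length_part_single symmetrizer_kernel_0 ) (metis lookup_single_eq lookup_zero zero_neq_one)
  then show ?thesis by (metis nichols_ideal_iff tword_Nil)
qed

section \<open>The bicharacter and the braided bracket\<close>

lemma multidegree_append: "multidegree (u @ v) = multidegree u + multidegree v"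
  by (simp add: multidegree_def fun_eq_iff plus_fun_apply)

lemma multidegree_Nil: "multidegree [] = 0"
  by (simp add: multidegree_def fun_eq_iff zero_fun_apply)

lemma bicharacter_add_left: "bicharacter q (\<alpha> + \<beta>) \<gamma> = bicharacter q \<alpha> \<gamma> * bicharacter q \<beta> \<gamma>"
  by (simp add: bicharacter_def plus_fun_apply distrib_right power_add prod.distrib)

lemma bicharacter_add_right: "bicharacter q \<gamma> (\<alpha> + \<beta>) = bicharacter q \<gamma> \<alpha> * bicharacter q \<gamma> \<beta>"
  by (simp add: bicharacter_def plus_fun_apply distrib_left power_add prod.distrib)

lemma bicharacter_zero [simp]: "bicharacter q 0 \<gamma> = 1" "bicharacter q \<gamma> 0 = 1"
  by (simp_all add: bicharacter_def zero_fun_apply)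

lemma bicharacter_letters: "bicharacter q (multidegree [i]) (multidegree [j]) = q i j"
proof -
  have "bicharacter q (multidegree [i]) (multidegree [j])
      = (\<Prod>a\<in>UNIV. \<Prod>b\<in>UNIV. if b = j then (if a = i then q a b else 1) else 1)"
    unfolding bicharacter_def multidegree_def by (intro prod.cong) auto
  then show ?thesis by simp
qed

lemma bicharacter_words:
  "bicharacter q (multidegree v) (multidegree u) = prod_list (map (\<lambda>j. bicharacter q (multidegree v) (multidegree [j])) u)"
proof (induction u)
  case (Cons j u)
  then show ?case
    using multidegree_append[of "[j]" u] by (simp add: bicharacter_add_right)
qed (simp add: multidegree_Nil)

lemma bicharacter_words':
  "bicharacter q (multidegree v) (multidegree u) = prod_list (map (\<lambda>i. bicharacter q (multidegree [i]) (multidegree u)) v)"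
proof (induction v)
  case (Cons j v)
  then show ?case
    using multidegree_append[of "[j]" v] by (simp add: bicharacter_add_left)
qed (simp add: multidegree_Nil)

text \<open>The bicharacter factor at a word \<open>u\<close> is a product over the letters of
  \<open>u\<close>, so even for inhomogeneous \<open>f\<close> the subtracted term only involves a
  rescaling of \<open>f\<close>. A two-sided ideal stable under \<open>scaling\<close> is therefore
  stable under brackets.\<close>

lemma tensor_bracket_word_right:
  "tensor_bracket q f (tword v) =
     tword v * f - scaling (\<lambda>j. bicharacter q (multidegree v) (multidegree [j])) f * tword v"
proof -
  have "tensor_bracket q f (tword v) = linear_extension (\<lambda>u. tword v * tword u -
      Poly_Mapping.single u (prod_list (map (\<lambda>j. bicharacter q (multidegree v) (multidegree [j])) u)) * tword v) f"
    unfolding tensor_bracket_def linear_extension_word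
    by (intro linear_extension_cong) (simp add: tensor_single_mult flip: bicharacter_words)
  then show ?thesis
    by (simp only: linear_extension_fun_diff linear_extension_fun_mult_left linear_extension_fun_mult_right
        linear_extension_tword scaling_def)
qed

lemma tensor_bracket_word_left:
  "tensor_bracket q (tword u) g =
     g * tword u - tword u * scaling (\<lambda>i. bicharacter q (multidegree [i]) (multidegree u)) g"
proof -
  have "tensor_bracket q (tword u) g = linear_extension (\<lambda>v. tword v * tword u -
      tword u * Poly_Mapping.single v (prod_list (map (\<lambda>i. bicharacter q (multidegree [i]) (multidegree u)) v))) g"
    unfolding tensor_bracket_def linear_extension_word
    by (intro linear_extension_cong) (simp add: tensor_single_mult flip: bicharacter_words')
  then show ?thesis
    by (simp only: linear_extension_fun_diff linear_extension_fun_mult_left linear_extension_fun_mult_right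
        linear_extension_tword scaling_def)
qed

lemma tensor_bracket_add_left: "tensor_bracket q (f + f') g = tensor_bracket q f g + tensor_bracket q f' g"
  by (simp add: tensor_bracket_def linear_extension_add)

lemma tensor_bracket_add_right: "tensor_bracket q f (g + g') = tensor_bracket q f g + tensor_bracket q f g'"
  by (simp add: tensor_bracket_def linear_extension_add linear_extension_fun_add)

lemma tensor_bracket_scale_left: "tensor_bracket q (tscalar c * f) g = tscalar c * tensor_bracket q f g"
  by (simp add: tensor_bracket_def linear_extension_scale)

lemma tensor_bracket_scale_right: "tensor_bracket q f (tscalar c * g) = tscalar c * tensor_bracket q f g"
  by (simp add: tensor_bracket_def linear_extension_scale linear_extension_fun_mult_left)

lemma tensor_bracket_zero [simp]: "tensor_bracket q 0 g = 0" "tensor_bracket q f 0 = 0"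
  by (simp add: tensor_bracket_def, simp add: tensor_bracket_def linear_extension_def)

lemma tensor_bracket_nichols_ideal:
  assumes "f \<in> nichols_ideal q"
  shows "tensor_bracket q f g \<in> nichols_ideal q" and "tensor_bracket q g f \<in> nichols_ideal q"
proof -
  show "tensor_bracket q f g \<in> nichols_ideal q"
  proof (induction g rule: tensor_induct)
    case (single v c)
    have "tensor_bracket q f (tword v) \<in> nichols_ideal q"
      unfolding tensor_bracket_word_right using assms
      by (intro nichols_ideal_diff nichols_ideal_mult nichols_ideal_scaling)
    then show ?case
      by (simp add: single_eq_tscalar_tword[of v c] tensor_bracket_scale_right nichols_ideal_scale)
  qed (simp_all add: tensor_bracket_add_right nichols_ideal_add)
  show "tensor_bracket q g f \<in> nichols_ideal q"
  proof (induction g rule: tensor_induct)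
    case (single v c)
    have "tensor_bracket q (tword v) f \<in> nichols_ideal q"
      unfolding tensor_bracket_word_left using assms
      by (intro nichols_ideal_diff nichols_ideal_mult nichols_ideal_scaling)
    then show ?case
      by (simp add: single_eq_tscalar_tword[of v c] tensor_bracket_scale_left nichols_ideal_scale)
  qed (simp_all add: tensor_bracket_add_left nichols_ideal_add)
qed

lemma homogeneous_single: "homogeneous (multidegree w) (Poly_Mapping.single w c)"
  by (simp add: homogeneous_def)

lemma homogeneous_add: "homogeneous \<alpha> f \<Longrightarrow> homogeneous \<alpha> g \<Longrightarrow> homogeneous \<alpha> (f + g)"
  using keys_add[of f g] by (auto simp: homogeneous_def)

lemma homogeneous_mult: "homogeneous \<alpha> f \<Longrightarrow> homogeneous \<beta> g \<Longrightarrow> homogeneous (\<alpha> + \<beta>) (f * g)"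
  unfolding homogeneous_def
proof
  fix w assume *: "\<forall>w\<in>Poly_Mapping.keys f. multidegree w = \<alpha>"
    "\<forall>w\<in>Poly_Mapping.keys g. multidegree w = \<beta>" "w \<in> Poly_Mapping.keys (f * g)"
  then obtain u v where "u \<in> Poly_Mapping.keys f" "v \<in> Poly_Mapping.keys g" "w = u @ v"
    using keys_mult[of f g] unfolding plus_list_def by blast
  with * show "multidegree w = \<alpha> + \<beta>" by (simp add: multidegree_append)
qed

lemma homogeneous_scale: "homogeneous \<alpha> f \<Longrightarrow> homogeneous \<alpha> (tscalar c * f)"
  using homogeneous_mult[OF homogeneous_single[of "[]" c], of \<alpha> f] by (simp add: multidegree_Nil)

lemma homogeneous_diff: "homogeneous \<alpha> f \<Longrightarrow> homogeneous \<alpha> g \<Longrightarrow> homogeneous \<alpha> (f - g)"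
  using homogeneous_add[of \<alpha> f "- g"] by (simp add: homogeneous_def[of _ "- g"] homogeneous_def[of _ g] in_keys_iff)

lemma homogeneous_bracket:
  assumes "homogeneous \<alpha> f" "homogeneous \<beta> g"
  shows "homogeneous (\<alpha> + \<beta>) (tensor_bracket q f g)"
proof -
  have "homogeneous (\<alpha> + \<beta>) (g * f)"
    unfolding add.commute[of \<alpha> \<beta>] by (rule homogeneous_mult[OF assms(2,1)])
  moreover have "homogeneous (\<alpha> + \<beta>) (f * g)"
    by (rule homogeneous_mult[OF assms])
  ultimately show ?thesis
    by (simp add: tensor_bracket_homogeneous[OF assms] homogeneous_diff homogeneous_scale)
qed

definition total_degree :: "('n::finite \<Rightarrow> nat) \<Rightarrow> nat" where
  "total_degree \<alpha> = sum \<alpha> UNIV"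

lemma total_degree_add: "total_degree (\<alpha> + \<beta>) = total_degree \<alpha> + total_degree \<beta>"
  by (simp add: total_degree_def plus_fun_apply sum.distrib)

lemma total_degree_zero: "total_degree 0 = 0"
  by (simp add: total_degree_def zero_fun_apply)

lemma total_degree_word: "total_degree (multidegree w) = length w"
  unfolding total_degree_def multidegree_def by (rule sum_count_set) auto

lemma homogeneous_tensor_power: "homogeneous \<alpha> f \<Longrightarrow> f \<in> tensor_power (total_degree \<alpha>)"
  by (auto simp: homogeneous_def tensor_power_def total_degree_word)

lemma scaling_homogeneous_eq:
  assumes "homogeneous \<beta> g"
  shows "scaling (q j) g = tscalar (bicharacter q (multidegree [j]) \<beta>) * g"
proof (rule scaling_homogeneous)
  fix w assume "w \<in> Poly_Mapping.keys g"
  then have "\<beta> = multidegree w" using assms by (simp add: homogeneous_def)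
  have "bicharacter q (multidegree [j]) (multidegree w) = prod_list (map (q j) w)"
    by (subst bicharacter_words) (simp add: bicharacter_letters)
  with \<open>\<beta> = multidegree w\<close> show "prod_list (map (q j) w) = bicharacter q (multidegree [j]) \<beta>"
    by simp
qed

section \<open>Lie-closed subspaces of the tensor algebra\<close>

text \<open>As a constant of its own it makes the vector space laws and \<open>span\<close>
  available and lets scalars be pulled out of products by rewriting.\<close>

definition tscale :: "'a::field_char_0 \<Rightarrow> ('n, 'a) tensor \<Rightarrow> ('n, 'a) tensor" where
  "tscale c f = tscalar c * f"

interpretation tensor_space: vector_space tscale
  by standard (simp_all add: tscale_def distrib_left distrib_right tscalar_add tscalar_mult_assoc tscalar_one)

lemma tscale_mult_left [simp]: "tscale c f * g = tscale c (f * g)"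
  by (simp add: tscale_def mult.assoc)

lemma tscale_mult_right [simp]: "f * tscale c g = tscale c (f * g)"
  by (simp add: tscale_def tscalar_left_commute[of f])

lemmas tscale_simps = tensor_space.scale_right_distrib tensor_space.scale_right_diff_distrib
  tensor_space.scale_left_distrib tensor_space.scale_left_diff_distrib

text \<open>Allows a property of all degrees, such as \<open>radical\<close>, to be proved by
  induction on words.\<close>

lemma multidegree_surj:
  fixes \<alpha> :: "'n::finite \<Rightarrow> nat"
  shows "\<exists>w. multidegree w = \<alpha>"
proof -
  obtain w where w: "mset w = (\<Sum>i\<in>UNIV. replicate_mset (\<alpha> i) i)"
    using ex_mset by blast
  have "multidegree w i = \<alpha> i" for i
  proof -
    have "multidegree w i = count (\<Sum>i\<in>UNIV. replicate_mset (\<alpha> i) i) i"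
      by (simp add: multidegree_def count_mset flip: w)
    also have "\<dots> = \<alpha> i" by (simp add: count_sum)
    finally show ?thesis .
  qed
  then show ?thesis by blast
qed

locale diagonal_braiding =
  fixes q :: "'n::finite \<Rightarrow> 'n \<Rightarrow> 'a::field_char_0"
  assumes nonzero: "q i j \<noteq> 0"
begin

abbreviation "\<chi> \<equiv> bicharacter q"

abbreviation "\<I> \<equiv> nichols_ideal q"

abbreviation "br \<equiv> tensor_bracket q"

definition symm_bichar :: "('n \<Rightarrow> nat) \<Rightarrow> ('n \<Rightarrow> nat) \<Rightarrow> 'a" where
  "symm_bichar \<alpha> \<beta> = \<chi> \<alpha> \<beta> * \<chi> \<beta> \<alpha>"

definition radical :: "('n \<Rightarrow> nat) \<Rightarrow> bool" where
  "radical \<alpha> \<longleftrightarrow> (\<forall>\<beta>. symm_bichar \<alpha> \<beta> = 1)"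

lemma symm_bichar_commute: "symm_bichar \<alpha> \<beta> = symm_bichar \<beta> \<alpha>"
  by (simp add: symm_bichar_def mult.commute)

lemma symm_bichar_add_left: "symm_bichar (\<alpha> + \<beta>) \<gamma> = symm_bichar \<alpha> \<gamma> * symm_bichar \<beta> \<gamma>"
  by (simp add: symm_bichar_def bicharacter_add_left bicharacter_add_right)

lemma symm_bichar_add_right: "symm_bichar \<gamma> (\<alpha> + \<beta>) = symm_bichar \<gamma> \<alpha> * symm_bichar \<gamma> \<beta>"
  by (simp add: symm_bichar_def bicharacter_add_left bicharacter_add_right)

lemma radical_iff_letters: "radical \<alpha> \<longleftrightarrow> (\<forall>j. symm_bichar \<alpha> (multidegree [j]) = 1)"
proof
  assume *: "\<forall>j. symm_bichar \<alpha> (multidegree [j]) = 1"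
  have "symm_bichar \<alpha> (multidegree w) = 1" for w
  proof (induction w)
    case Nil
    then show ?case by (simp add: multidegree_Nil symm_bichar_def)
  next
    case (Cons j w)
    then show ?case
      using multidegree_append[of "[j]" w] * by (simp add: symm_bichar_add_right)
  qed
  then show "radical \<alpha>"
    unfolding radical_def using multidegree_surj by metis
qed (simp add: radical_def)

lemma bracket_eq:
  "homogeneous \<alpha> f \<Longrightarrow> homogeneous \<beta> g \<Longrightarrow> br f g = g * f - tscale (\<chi> \<beta> \<alpha>) (f * g)"
  by (simp add: tensor_bracket_homogeneous tscale_def)

lemma tscale_nichols_ideal: "f \<in> \<I> \<Longrightarrow> tscale c f \<in> \<I>"
  by (simp add: tscale_def nichols_ideal_scale)

end

text \<open>\<open>M\<close> plays the preimage of L(V) in the tensor algebra. The bound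
  \<open>D\<close> is the form in which the finite dimension of L(V) enters.\<close>

locale bracket_closed = diagonal_braiding q
  for q :: "'n::finite \<Rightarrow> 'n \<Rightarrow> 'a::field_char_0" +
  fixes M :: "('n, 'a) tensor set" and D :: nat
  assumes add_closed: "f \<in> M \<Longrightarrow> g \<in> M \<Longrightarrow> f + g \<in> M"
    and scale_closed: "f \<in> M \<Longrightarrow> tscale c f \<in> M"
    and letter_closed: "tword [i] \<in> M"
    and br_closed: "f \<in> M \<Longrightarrow> g \<in> M \<Longrightarrow> br f g \<in> M"
    and large_in_ideal: "f \<in> M \<Longrightarrow> f \<in> tensor_power m \<Longrightarrow> m > D \<Longrightarrow> f \<in> \<I>"
begin

section \<open>Products that stay in \<open>M\<close>\<close>

lemma diff_closed: "f \<in> M \<Longrightarrow> g \<in> M \<Longrightarrow> f - g \<in> M"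
  using add_closed[of f "- g"] scale_closed[of g "-1"] by simp

lemma scale_closed_iff: "c \<noteq> 0 \<Longrightarrow> tscale c f \<in> M \<longleftrightarrow> f \<in> M"
  using scale_closed[of f c] scale_closed[of "tscale c f" "inverse c"] by auto

text \<open>
  If \<open>symm_bichar \<alpha> \<beta> \<noteq> 1\<close>, the two brackets \<open>[f, g]\<close> and \<open>[g, f]\<close> are linearly independent
  combinations of \<open>f g\<close> and \<open>g f\<close>.
\<close>

lemma mult_closed:
  assumes f: "f \<in> M" "homogeneous \<alpha> f" and g: "g \<in> M" "homogeneous \<beta> g"
    and ne: "symm_bichar \<alpha> \<beta> \<noteq> 1"
  shows "f * g \<in> M"
proof -
  have "tscale (1 - symm_bichar \<alpha> \<beta>) (f * g) = br g f + tscale (\<chi> \<alpha> \<beta>) (br f g)"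
    by (simp add: bracket_eq[OF f(2) g(2)] bracket_eq[OF g(2) f(2)] tscale_simps symm_bichar_def)
  also have "\<dots> \<in> M"
    using f g by (intro add_closed scale_closed br_closed)
  finally show ?thesis using ne by (simp add: scale_closed_iff)
qed

text \<open>The values at \<alpha> and \<beta> may multiply to 1, and then
  \<open>mult_closed\<close> does not apply to \<open>br a b\<close> and \<open>y\<close>. But it
  applies to \<open>a\<close> and to \<open>b\<close>, and brackets with the resulting products
  isolate \<open>br a b * y\<close>.\<close>

lemma bracket_mult_closed:
  assumes a: "a \<in> M" "homogeneous \<alpha> a" and b: "b \<in> M" "homogeneous \<beta> b" and y: "y \<in> M" "homogeneous \<eta> y"
    and ne: "symm_bichar \<alpha> \<eta> \<noteq> 1" "symm_bichar \<beta> \<eta> \<noteq> 1"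
  shows "br a b * y \<in> M"
proof -
  let ?u = "br a b"
  have prods: "a * y \<in> M" "y * a \<in> M" "b * y \<in> M" "y * b \<in> M"
    using mult_closed[OF a y] mult_closed[OF y a] mult_closed[OF b y] mult_closed[OF y b] ne
    by (simp_all add: symm_bichar_commute)
  note hom = homogeneous_mult[OF a(2) y(2)] homogeneous_mult[OF y(2) a(2)]
    homogeneous_mult[OF b(2) y(2)] homogeneous_mult[OF y(2) b(2)]
  define R1 where "R1 = br a (y * b)"
  define R2 where "R2 = br (a * y) b"
  define R3 where "R3 = br a (b * y)"
  define R4 where "R4 = br (y * a) b"
  define R5 where "R5 = br y ?u"
  \<comment> \<open>The coefficients are chosen to cancel: \<open>R1\<close> removes
    \<open>y * b * a\<close> from \<open>R5\<close>, \<open>R2\<close> then removes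
    \<open>a * y * b\<close>, and \<open>R3 - R4\<close>, in which \<open>b * y * a\<close> drops
    out, removes \<open>y * a * b\<close>. What remains of \<open>R2\<close> and \<open>R3\<close>
    is a multiple of \<open>?u * y\<close>.\<close>
  have "tscale (1 - symm_bichar \<alpha> \<eta>) (?u * y) =
      R5 + tscale (\<chi> \<alpha> \<eta> * \<chi> \<beta> \<eta>) R1 - tscale (symm_bichar \<alpha> \<eta>) R2 - tscale (\<chi> \<alpha> \<eta>) (R3 - R4)"
    unfolding R1_def R2_def R3_def R4_def R5_def
      bracket_eq[OF y(2) homogeneous_bracket[OF a(2) b(2)]]
    unfolding bracket_eq[OF a(2) b(2)]
      bracket_eq[OF a(2) hom(4)] bracket_eq[OF hom(1) b(2)] bracket_eq[OF a(2) hom(3)] bracket_eq[OF hom(2) b(2)]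
    by (simp add: tscale_simps symm_bichar_def bicharacter_add_left bicharacter_add_right
        mult.assoc left_diff_distrib right_diff_distrib)
       (simp add: algebra_simps)
  also have "\<dots> \<in> M"
    unfolding R1_def R2_def R3_def R4_def R5_def using a b y prods
    by (intro add_closed diff_closed scale_closed br_closed)
  finally show ?thesis using ne by (simp add: scale_closed_iff)
qed

text \<open>An Ore-type condition modulo the ideal: enough factors \<open>u\<close> to the left of
  \<open>b\<close> can be traded for \<open>k\<close> factors \<open>u\<close> on the far
  right.\<close>

definition absorbs :: "('n, 'a) tensor \<Rightarrow> ('n, 'a) tensor \<Rightarrow> bool" where
  "absorbs u b \<longleftrightarrow> (\<forall>k. \<exists>K t. u ^ K * b - t * u ^ k \<in> \<I>)"

lemma power_add_absorb:
  assumes "u ^ K * b - t * u ^ k \<in> \<I>"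
  shows "u ^ (n + K) * b - (u ^ n * t) * u ^ k \<in> \<I>"
  using nichols_ideal_mult(2)[OF assms, of "u ^ n"]
  by (simp add: power_add right_diff_distrib mult.assoc)

lemma absorb_two:
  assumes "u ^ K * b - t * u ^ k \<in> \<I>" "u ^ K' * b' - t' * u ^ k' \<in> \<I>"
  shows "\<exists>N s s'. u ^ N * b - s * u ^ k \<in> \<I> \<and> u ^ N * b' - s' * u ^ k' \<in> \<I>"
  using power_add_absorb[OF assms(1), of K'] power_add_absorb[OF assms(2), of K]
  by (metis add.commute)

lemma absorbs_add: "absorbs u b \<Longrightarrow> absorbs u b' \<Longrightarrow> absorbs u (b + b')"
  unfolding absorbs_def
proof
  fix k
  assume "\<forall>k. \<exists>K t. u ^ K * b - t * u ^ k \<in> \<I>" "\<forall>k. \<exists>K t. u ^ K * b' - t * u ^ k \<in> \<I>"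
  then obtain N s s' where "u ^ N * b - s * u ^ k \<in> \<I>" "u ^ N * b' - s' * u ^ k \<in> \<I>"
    using absorb_two by meson
  from nichols_ideal_add[OF this] have "u ^ N * (b + b') - (s + s') * u ^ k \<in> \<I>"
    by (simp add: algebra_simps)
  then show "\<exists>K t. u ^ K * (b + b') - t * u ^ k \<in> \<I>" by blast
qed

text \<open>The exponent \<open>K'\<close> that \<open>b'\<close> needs on its left is the one
  requested on the right of \<open>b\<close>.\<close>

lemma absorbs_mult:
  assumes "absorbs u b" "absorbs u b'"
  shows "absorbs u (b * b')"
  unfolding absorbs_def
proof
  fix k
  obtain K' t' where 1: "u ^ K' * b' - t' * u ^ k \<in> \<I>"
    using assms(2) unfolding absorbs_def by blast
  obtain K t where 2: "u ^ K * b - t * u ^ K' \<in> \<I>"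
    using assms(1) unfolding absorbs_def by blast
  have "(u ^ K * b - t * u ^ K') * b' + t * (u ^ K' * b' - t' * u ^ k) \<in> \<I>"
    using 1 2 by (intro nichols_ideal_add nichols_ideal_mult)
  then have "u ^ K * (b * b') - (t * t') * u ^ k \<in> \<I>"
    by (simp add: left_diff_distrib right_diff_distrib mult.assoc)
  then show "\<exists>K t. u ^ K * (b * b') - t * u ^ k \<in> \<I>" by blast
qed

lemma absorbs_scalar: "absorbs u (tscalar c)"
  unfolding absorbs_def
proof
  fix k
  have "u ^ k * tscalar c - tscalar c * u ^ k = 0"
    by (simp add: tscalar_commute)
  then show "\<exists>K t. u ^ K * tscalar c - t * u ^ k \<in> \<I>"
    by (metis nichols_ideal_zero)
qed

text \<open>Induction towards larger degrees, where \<open>M\<close> falls into the ideal: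
  \<open>u * y\<close> is a multiple of \<open>y * u\<close> plus \<open>br y u\<close>, which lies
  in \<open>M\<close> and has larger degree than \<open>y\<close>.\<close>

lemma absorbs_homogeneous:
  assumes u: "u \<in> M" "homogeneous \<alpha> u" "total_degree \<alpha> > 0" and y: "y \<in> M" "homogeneous \<eta> y"
  shows "absorbs u y"
  using y
proof (induction "Suc D - total_degree \<eta>" arbitrary: y \<eta> rule: less_induct)
  case less
  note hom = homogeneous_tensor_power[OF less.prems(2)]
  show ?case
  proof (cases "total_degree \<eta> > D")
    case True
    then have "u ^ 0 * y - 0 * u ^ k \<in> \<I>" for k
      using large_in_ideal[OF less.prems(1) hom] by simp
    then show ?thesis unfolding absorbs_def by blast
  next
    case False
    define y' where "y' = br y u"
    define c where "c = \<chi> \<alpha> \<eta>"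
    have y': "u * y = tscale c (y * u) + y'"
      by (simp add: y'_def bracket_eq[OF less.prems(2) u(2)] c_def)
    have "absorbs u y'"
      unfolding y'_def using False u(3)
      by (intro less.hyps[OF _ br_closed[OF less.prems(1) u(1)] homogeneous_bracket[OF less.prems(2) u(2)]])
         (simp add: total_degree_add)
    have "\<exists>K t. u ^ K * y - t * u ^ k \<in> \<I>" for k
    proof (induction k)
      case 0
      have "u ^ 0 * y - y * u ^ 0 \<in> \<I>" by simp
      then show ?case by blast
    next
      case (Suc k)
      then obtain K t where 1: "u ^ K * y - t * u ^ k \<in> \<I>" by blast
      obtain K' t' where 2: "u ^ K' * y' - t' * u ^ Suc k \<in> \<I>"
        using \<open>absorbs u y'\<close> unfolding absorbs_def by blast
      obtain N s s' where N: "u ^ N * y - s * u ^ k \<in> \<I>" "u ^ N * y' - s' * u ^ Suc k \<in> \<I>"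
        using absorb_two[OF 1 2] by blast
      \<comment> \<open>One \<open>u\<close> is commuted past \<open>y\<close> and supplies the
        additional factor on the right; the other \<open>N\<close> copies are handled by the
        induction on \<open>k\<close> and by the hypothesis on \<open>y'\<close>.\<close>
      have "u ^ Suc N * y = u ^ N * (u * y)"
        by (simp only: power_Suc2 mult.assoc)
      also have "\<dots> = tscale c (u ^ N * y * u) + u ^ N * y'"
        by (simp add: y' distrib_left mult.assoc)
      finally have "u ^ Suc N * y - (tscale c s + s') * u ^ Suc k =
          tscale c ((u ^ N * y - s * u ^ k) * u) + (u ^ N * y' - s' * u ^ Suc k)"
        by (simp only: power_Suc2 left_diff_distrib distrib_right tensor_space.scale_right_diff_distrib
            tscale_mult_left mult.assoc) simp
      moreover have "tscale c ((u ^ N * y - s * u ^ k) * u) + (u ^ N * y' - s' * u ^ Suc k) \<in> \<I>"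
        by (intro nichols_ideal_add tscale_nichols_ideal nichols_ideal_mult N)
      ultimately show ?case by metis
    qed
    then show ?thesis by (simp add: absorbs_def)
  qed
qed

lemma absorbs_all:
  assumes u: "u \<in> M" "homogeneous \<alpha> u" "total_degree \<alpha> > 0"
  shows "absorbs u b"
proof (induction b rule: tensor_induct)
  case zero
  then show ?case using absorbs_scalar[of u 0] by simp
next
  case (add f g)
  then show ?case by (rule absorbs_add)
next
  case (single w c)
  have "absorbs u (tword w)"
  proof (induction w)
    case Nil
    then show ?case by (rule absorbs_scalar)
  next
    case (Cons i w)
    have "absorbs u (tword [i])"
      by (rule absorbs_homogeneous[OF u letter_closed homogeneous_single])
    from absorbs_mult[OF this Cons] show ?case by (simp add: tensor_single_mult)
  qed
  from absorbs_mult[OF absorbs_scalar this, of c] show ?case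
    by (simp add: tensor_single_mult)
qed

section \<open>Nilpotency from products with a letter\<close>

lemma homogeneous_power_ex: "homogeneous \<alpha> u \<Longrightarrow> \<exists>\<beta>. homogeneous \<beta> (u ^ k) \<and> total_degree \<beta> = k * total_degree \<alpha>"
proof (induction k)
  case 0
  have "homogeneous 0 (u ^ 0)"
    by (metis homogeneous_single multidegree_Nil power_0 tscalar_one)
  then show ?case by (metis mult_zero_left total_degree_zero)
next
  case (Suc k)
  then obtain \<beta> where "homogeneous \<beta> (u ^ k)" "total_degree \<beta> = k * total_degree \<alpha>" by blast
  with Suc.prems have "homogeneous (\<alpha> + \<beta>) (u ^ Suc k)" "total_degree (\<alpha> + \<beta>) = Suc k * total_degree \<alpha>"
    by (auto simp: homogeneous_mult total_degree_add)
  then show ?case by blast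
qed

text \<open>
  Apply \<open>skew_deriv q j\<close> to \<open>u\<^sup>k x\<^sub>j \<in> \<I>\<close>: it yields \<open>u\<^sup>k\<close> plus a term
  \<open>skew_deriv q j (u\<^sup>k) x\<^sub>j\<close>, which lies in \<open>\<I>\<close> for large \<open>k\<close> because powers of \<open>u\<close> can be moved
  to the right past any element.
\<close>

lemma power_in_ideal_of_letter:
  assumes u: "u \<in> M" "homogeneous \<alpha> u" "total_degree \<alpha> > 0"
    and k0: "\<And>k. k \<ge> k0 \<Longrightarrow> u ^ k * tword [j] \<in> \<I>"
  shows "\<exists>k. u ^ k \<in> \<I>"
proof -
  let ?x = "tword [j]" and ?d = "skew_deriv q j"
  let ?v = "?d (u ^ k0)"
  \<comment> \<open>When \<open>u\<close> is split off on the left, the twisted term of the Leibniz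
    rule ends in \<open>u ^ (n + k0) * ?x\<close>, which is in the ideal. So \<open>u\<close> passes
    through the derivative.\<close>
  have *: "?d (u ^ (n + k0)) * ?x - u ^ n * ?v * ?x \<in> \<I>" for n
  proof (induction n)
    case (Suc n)
    obtain \<beta> where "homogeneous \<beta> (u ^ (n + k0))"
      using homogeneous_power_ex[OF u(2)] by blast
    then obtain c where "scaling (q j) (u ^ (n + k0)) = tscale c (u ^ (n + k0))"
      using scaling_homogeneous_eq by (metis tscale_def)
    then have "?d (u ^ (Suc n + k0)) * ?x - u ^ Suc n * ?v * ?x =
        u * (?d (u ^ (n + k0)) * ?x - u ^ n * ?v * ?x) + tscale c (?d u * (u ^ (n + k0) * ?x))"
      by (simp add: skew_deriv_mult distrib_right right_diff_distrib mult.assoc)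
    also have "\<dots> \<in> \<I>"
      using k0[of "n + k0"] Suc.IH by (simp add: nichols_ideal_add nichols_ideal_mult(2) tscale_nichols_ideal)
    finally show ?case .
  qed simp
  obtain K t where "u ^ K * ?v - t * u ^ k0 \<in> \<I>"
    using absorbs_all[OF u, of ?v] unfolding absorbs_def by blast
  from nichols_ideal_add[OF nichols_ideal_mult(1)[OF this, of ?x] nichols_ideal_mult(2)[OF k0[of k0], of t]]
  have "u ^ K * ?v * ?x \<in> \<I>"
    by (simp add: left_diff_distrib mult.assoc)
  from nichols_ideal_add[OF *[of K] this] have 1: "?d (u ^ (K + k0)) * ?x \<in> \<I>"
    by simp
  have "?d (u ^ (K + k0) * ?x) = u ^ (K + k0) + tscale (q j j) (?d (u ^ (K + k0)) * ?x)"
    by (simp add: skew_deriv_mult skew_deriv_letter scaling_single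
        single_eq_tscalar_tword[of "[j]" "q j j"] flip: tscale_def)
  moreover have "?d (u ^ (K + k0) * ?x) \<in> \<I>"
    by (intro nichols_ideal_skew_deriv k0) simp
  ultimately have "u ^ (K + k0) \<in> \<I>"
    using nichols_ideal_diff tscale_nichols_ideal[OF 1] by (metis add_diff_cancel_right')
  then show ?thesis by blast
qed

text \<open>Here \<gamma> is the degree on which the criterion is tested: that of \<open>u\<close>,
  or of one factor of \<open>u\<close> if \<open>u\<close> has radical degree. Since
  \<open>symm_bichar \<gamma> \<alpha> = 1\<close>, the test has the same outcome for all
  \<open>u ^ k * tword [j]\<close>; they remain in \<open>M\<close> while their degrees grow beyond
  \<open>D\<close>.\<close>

lemma power_in_ideal:
  assumes u: "u \<in> M" "homogeneous \<alpha> u" "total_degree \<alpha> > 0"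
    and \<gamma>: "symm_bichar \<gamma> \<alpha> = 1" "\<not> radical \<gamma>"
    and mult: "\<And>y \<eta>. y \<in> M \<Longrightarrow> homogeneous \<eta> y \<Longrightarrow> symm_bichar \<gamma> \<eta> \<noteq> 1 \<Longrightarrow> u * y \<in> M"
  shows "\<exists>k. u ^ k \<in> \<I>"
proof -
  obtain j where j: "symm_bichar \<gamma> (multidegree [j]) \<noteq> 1"
    using \<gamma>(2) radical_iff_letters by blast
  have *: "\<exists>\<eta>. homogeneous \<eta> (u ^ k * tword [j]) \<and> u ^ k * tword [j] \<in> M \<and>
      symm_bichar \<gamma> \<eta> \<noteq> 1 \<and> total_degree \<eta> = Suc (k * total_degree \<alpha>)" for k
  proof (induction k)
    case 0
    show ?case
      using j letter_closed homogeneous_single[of "[j]" 1] total_degree_word[of "[j]"] by auto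
  next
    case (Suc k)
    then obtain \<eta> where \<eta>: "homogeneous \<eta> (u ^ k * tword [j])" "u ^ k * tword [j] \<in> M"
      "symm_bichar \<gamma> \<eta> \<noteq> 1" "total_degree \<eta> = Suc (k * total_degree \<alpha>)" by blast
    have "homogeneous (\<alpha> + \<eta>) (u ^ Suc k * tword [j])"
      using homogeneous_mult[OF u(2) \<eta>(1)] by (simp add: mult.assoc)
    moreover have "u ^ Suc k * tword [j] \<in> M"
      using mult[OF \<eta>(2,1,3)] by (simp add: mult.assoc)
    moreover have "symm_bichar \<gamma> (\<alpha> + \<eta>) \<noteq> 1"
      using \<gamma>(1) \<eta>(3) by (simp add: symm_bichar_add_right)
    ultimately show ?case using \<eta>(4) by (auto simp: total_degree_add)
  qed
  have "u ^ k * tword [j] \<in> \<I>" if "k \<ge> D" for k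
  proof -
    obtain \<eta> where \<eta>: "homogeneous \<eta> (u ^ k * tword [j])" "u ^ k * tword [j] \<in> M"
      "total_degree \<eta> = Suc (k * total_degree \<alpha>)" using * by blast
    have "D \<le> k * total_degree \<alpha>" using that u(3) by (metis One_nat_def Suc_leI le_trans mult.right_neutral mult_le_mono2)
    then show ?thesis
      using large_in_ideal[OF \<eta>(2) homogeneous_tensor_power[OF \<eta>(1)]] \<eta>(3) by simp
  qed
  then show ?thesis
    by (rule power_in_ideal_of_letter[OF u])
qed

end

section \<open>Iterated brackets\<close>

context diagonal_braiding
begin

text \<open>
  Brackets of two generators of radical degree are left out: by the Jacobi identity they are
  linear combinations of the other ones, and for the other ones \<open>bracket_mult_closed\<close> applies.
\<close>

inductive lie_monomial :: "('n \<Rightarrow> nat) \<Rightarrow> ('n, 'a) tensor \<Rightarrow> bool" where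
  letter: "lie_monomial (multidegree [i]) (tword [i])"
| bracket: "lie_monomial \<alpha> a \<Longrightarrow> lie_monomial \<beta> b \<Longrightarrow> \<not> (radical \<alpha> \<and> radical \<beta>)
    \<Longrightarrow> lie_monomial (\<alpha> + \<beta>) (br a b)"

lemma lie_monomial_homogeneous: "lie_monomial \<alpha> a \<Longrightarrow> homogeneous \<alpha> a"
  by (induction rule: lie_monomial.induct) (auto intro: homogeneous_single homogeneous_bracket)

lemma lie_monomial_degree: "lie_monomial \<alpha> a \<Longrightarrow> total_degree \<alpha> > 0"
  by (induction rule: lie_monomial.induct) (simp_all add: total_degree_word total_degree_add)

definition lie_monomials :: "nat \<Rightarrow> ('n, 'a) tensor set" where
  "lie_monomials n = {a. \<exists>\<alpha>. lie_monomial \<alpha> a \<and> total_degree \<alpha> \<le> n}"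

text \<open>Degrees are positive, so both operands of a bracket of degree at most
  \<open>Suc n\<close> have degree at most \<open>n\<close>.\<close>

lemma finite_lie_monomials: "finite (lie_monomials n)"
proof (induction n)
  case 0
  have "lie_monomials 0 = {}"
    using lie_monomial_degree by (fastforce simp: lie_monomials_def)
  then show ?case by simp
next
  case (Suc n)
  have "lie_monomials (Suc n) \<subseteq> range (\<lambda>i. tword [i]) \<union> (\<lambda>(a, b). br a b) ` (lie_monomials n \<times> lie_monomials n)"
  proof
    fix c assume "c \<in> lie_monomials (Suc n)"
    then obtain \<gamma> where c: "lie_monomial \<gamma> c" "total_degree \<gamma> \<le> Suc n"
      by (auto simp: lie_monomials_def)
    from c(1) show "c \<in> range (\<lambda>i. tword [i]) \<union> (\<lambda>(a, b). br a b) ` (lie_monomials n \<times> lie_monomials n)"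
    proof cases
      case (letter i)
      then show ?thesis by simp
    next
      case (bracket \<alpha> a \<beta> b)
      with c(2) lie_monomial_degree[OF bracket(3)] lie_monomial_degree[OF bracket(4)]
      have "total_degree \<alpha> \<le> n" "total_degree \<beta> \<le> n" by (simp_all add: total_degree_add)
      with bracket have "(a, b) \<in> lie_monomials n \<times> lie_monomials n"
        by (auto simp: lie_monomials_def)
      with bracket(2) show ?thesis by (intro UnI2 image_eqI[of _ _ "(a, b)"]) auto
    qed
  qed
  then show ?case
    by (rule finite_subset) (use Suc in auto)
qed

text \<open>On the right, up to further scalars, \<open>a * c * d\<close> carries the factor
  \<open>symm_bichar \<alpha> \<delta>\<close> and \<open>c * a * d\<close> carries this factor
  minus 1. At the value 1 the former agrees with the left side and the latter vanishes.\<close>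

lemma jacobi:
  assumes a: "homogeneous \<alpha> a" and c: "homogeneous \<gamma> c" and d: "homogeneous \<delta> d"
    and "symm_bichar \<alpha> \<delta> = 1"
  shows "br (br c d) a = br c (br d a) + tscale (\<chi> \<alpha> \<delta>) (br (br c a) d)"
proof -
  have inv: "\<chi> \<alpha> \<delta> * \<chi> \<delta> \<alpha> = 1" using assms(4) by (simp add: symm_bichar_def)
  then have inv': "\<chi> \<alpha> \<delta> * (x * \<chi> \<delta> \<alpha>) = x" "\<chi> \<alpha> \<delta> * (\<chi> \<delta> \<alpha> * x) = x" for x
    by (metis mult.left_commute mult_1_right, metis mult.assoc mult_1_left)
  then have inv'': "\<chi> \<alpha> \<delta> * (x * (\<chi> \<delta> \<alpha> * y)) = x * y" for x y
    by (metis mult.assoc)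
  show ?thesis
    unfolding bracket_eq[OF homogeneous_bracket[OF c d] a] bracket_eq[OF c homogeneous_bracket[OF d a]]
      bracket_eq[OF homogeneous_bracket[OF c a] d]
    unfolding bracket_eq[OF c d] bracket_eq[OF d a] bracket_eq[OF c a]
    by (simp add: tscale_simps bicharacter_add_left bicharacter_add_right
        mult.assoc left_diff_distrib right_diff_distrib inv inv' inv'')
       (simp add: mult.commute mult.left_commute)
qed

text \<open>By multiplicativity the values of \<open>symm_bichar\<close> at \<alpha> and \<beta> are
  inverse to each other.\<close>

lemma radical_add_iff: "radical (\<alpha> + \<beta>) \<Longrightarrow> radical \<alpha> \<longleftrightarrow> radical \<beta>"
  unfolding radical_def by (auto simp: symm_bichar_add_left)

end

text \<open>Supplied by connectedness: with at least two vertices each vertex has a neighbour, and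
  there \<open>symm_bichar\<close> is not 1.\<close>

locale connected_diagonal_braiding = diagonal_braiding q
  for q :: "'n::finite \<Rightarrow> 'n \<Rightarrow> 'a::field_char_0" +
  assumes letter_not_radical: "\<not> radical (multidegree [i])"
begin

lemma radical_lie_monomial_cases:
  assumes "lie_monomial \<alpha> a" "radical \<alpha>"
  obtains \<gamma> c \<delta> d where "lie_monomial \<gamma> c" "lie_monomial \<delta> d" "\<not> radical \<gamma>" "\<not> radical \<delta>"
    "\<alpha> = \<gamma> + \<delta>" "a = br c d"
  using assms(1)
proof cases
  case (letter i)
  then show ?thesis using letter_not_radical assms(2) by blast
next
  case (bracket \<gamma> c \<delta> d)
  then show ?thesis using that radical_add_iff assms(2) by metis
qed

text \<open>If both degrees are radical, writing \<open>b = br c d\<close> puts the non-radical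
  \<open>c\<close> or \<open>d\<close> as an operand into every bracket on the right of the Jacobi
  identity, so all of them are admissible.\<close>

lemma lie_monomial_bracket_span:
  assumes a: "lie_monomial \<alpha> a" and b: "lie_monomial \<beta> b"
  shows "br b a \<in> tensor_space.span {g. lie_monomial (\<beta> + \<alpha>) g}"
proof (cases "radical \<alpha> \<and> radical \<beta>")
  case False
  then have "lie_monomial (\<beta> + \<alpha>) (br b a)"
    using a b by (intro bracket) auto
  then show ?thesis by (intro tensor_space.span_base) simp
next
  case True
  obtain \<gamma> c \<delta> d where cd: "lie_monomial \<gamma> c" "lie_monomial \<delta> d" "\<not> radical \<gamma>" "\<not> radical \<delta>"
    "\<beta> = \<gamma> + \<delta>" "b = br c d"
    using radical_lie_monomial_cases[OF b] True by metis
  have "symm_bichar \<alpha> \<delta> = 1" using True by (simp add: radical_def)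
  then have eq: "br b a = br c (br d a) + tscale (\<chi> \<alpha> \<delta>) (br (br c a) d)"
    unfolding cd(6) using a cd by (intro jacobi[of \<alpha> a \<gamma> c \<delta> d]) (auto intro: lie_monomial_homogeneous)
  have "lie_monomial (\<gamma> + (\<delta> + \<alpha>)) (br c (br d a))" "lie_monomial (\<gamma> + \<alpha> + \<delta>) (br (br c a) d)"
    using a cd by (auto intro!: bracket)
  moreover have "\<gamma> + (\<delta> + \<alpha>) = \<beta> + \<alpha>" "\<gamma> + \<alpha> + \<delta> = \<beta> + \<alpha>"
    by (simp_all add: cd(5) ac_simps)
  ultimately have "lie_monomial (\<beta> + \<alpha>) (br c (br d a))" "lie_monomial (\<beta> + \<alpha>) (br (br c a) d)"
    by simp_all
  then show ?thesis
    unfolding eq by (intro tensor_space.span_add tensor_space.span_scale tensor_space.span_base) auto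
qed

end

locale connected_bracket_closed = connected_diagonal_braiding q + bracket_closed q M D
  for q :: "'n::finite \<Rightarrow> 'n \<Rightarrow> 'a::field_char_0" and M D +
  assumes D_pos: "D > 0"
begin

lemma lie_monomial_closed: "lie_monomial \<alpha> a \<Longrightarrow> a \<in> M"
  by (induction rule: lie_monomial.induct) (auto intro: letter_closed br_closed)

lemma lie_monomial_nilpotent:
  assumes u: "lie_monomial \<alpha> u" and one: "\<chi> \<alpha> \<alpha> = 1"
  shows "\<exists>k. u ^ k \<in> \<I>"
proof (cases "radical \<alpha>")
  case False
  show ?thesis
  proof (rule power_in_ideal[OF lie_monomial_closed[OF u] lie_monomial_homogeneous[OF u] lie_monomial_degree[OF u] _ False])
    show "symm_bichar \<alpha> \<alpha> = 1" using one by (simp add: symm_bichar_def)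
    show "u * y \<in> M" if "y \<in> M" "homogeneous \<eta> y" "symm_bichar \<alpha> \<eta> \<noteq> 1" for y \<eta>
      using mult_closed[OF lie_monomial_closed[OF u] lie_monomial_homogeneous[OF u] that] .
  qed
next
  case True
  obtain \<gamma> c \<delta> d where cd: "lie_monomial \<gamma> c" "lie_monomial \<delta> d" "\<not> radical \<gamma>" "\<not> radical \<delta>"
    "\<alpha> = \<gamma> + \<delta>" "u = br c d"
    using radical_lie_monomial_cases[OF u True] by metis
  show ?thesis
  proof (rule power_in_ideal[OF lie_monomial_closed[OF u] lie_monomial_homogeneous[OF u] lie_monomial_degree[OF u] _ cd(3)])
    show "symm_bichar \<gamma> \<alpha> = 1" using True by (simp add: radical_def symm_bichar_commute[of \<gamma>])
    show "u * y \<in> M" if y: "y \<in> M" "homogeneous \<eta> y" "symm_bichar \<gamma> \<eta> \<noteq> 1" for y \<eta>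
    proof -
      \<comment> \<open>The degree of \<open>u\<close> is radical, so the test at \<gamma> decides
        the one at \<delta> as well.\<close>
      have "symm_bichar \<gamma> \<eta> * symm_bichar \<delta> \<eta> = 1"
        using True cd(5) by (simp add: radical_def symm_bichar_add_left)
      then have "symm_bichar \<delta> \<eta> \<noteq> 1" using y(3) by auto
      then show ?thesis
        unfolding cd(6) using cd y
        by (intro bracket_mult_closed[of c \<gamma> d \<delta> y \<eta>]) (auto intro: lie_monomial_closed lie_monomial_homogeneous)
    qed
  qed
qed

section \<open>The filtration by the number of factors\<close>

definition generators :: "('n, 'a) tensor set" where
  "generators = lie_monomials D"

text \<open>Including the ideal makes this the preimage of a filtration of the Nichols
  algebra.\<close>

definition filt :: "nat \<Rightarrow> ('n, 'a) tensor set" where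
  "filt k = tensor_space.span ({prod_list gs | gs. set gs \<subseteq> generators \<and> length gs \<le> k} \<union> \<I>)"

lemma filt_mono: "k \<le> l \<Longrightarrow> filt k \<subseteq> filt l"
  unfolding filt_def by (intro tensor_space.span_mono) auto

lemma ideal_subset_filt: "f \<in> \<I> \<Longrightarrow> f \<in> filt k"
  unfolding filt_def by (intro tensor_space.span_base) simp

lemma prod_list_filt: "set gs \<subseteq> generators \<Longrightarrow> length gs \<le> k \<Longrightarrow> prod_list gs \<in> filt k"
  unfolding filt_def by (intro tensor_space.span_base) auto

lemma filt_add: "f \<in> filt k \<Longrightarrow> g \<in> filt k \<Longrightarrow> f + g \<in> filt k"
  unfolding filt_def by (rule tensor_space.span_add)

lemma filt_scale: "f \<in> filt k \<Longrightarrow> tscale c f \<in> filt k"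
  unfolding filt_def by (rule tensor_space.span_scale)

lemma filt_induct [consumes 1, case_names zero add scale prod ideal]:
  assumes "f \<in> filt k" "P 0" "\<And>f g. P f \<Longrightarrow> P g \<Longrightarrow> P (f + g)" "\<And>c f. P f \<Longrightarrow> P (tscale c f)"
    and "\<And>gs. set gs \<subseteq> generators \<Longrightarrow> length gs \<le> k \<Longrightarrow> P (prod_list gs)" "\<And>f. f \<in> \<I> \<Longrightarrow> P f"
  shows "P f"
  using assms(1) unfolding filt_def
proof (rule tensor_space.span_induct)
  show "tensor_space.subspace {x. P x}"
    using assms(2-4) by (intro tensor_space.subspaceI) auto
qed (use assms(5,6) in auto)

lemma filt_mult:
  assumes "f \<in> filt k" "g \<in> filt l"
  shows "f * g \<in> filt (k + l)"
  using assms(1)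
proof (induction f rule: filt_induct)
  case (prod gs)
  from assms(2) show ?case
  proof (induction g rule: filt_induct)
    case (prod hs)
    then show ?case
      using prod_list_filt[of "gs @ hs" "k + l"] \<open>set gs \<subseteq> generators\<close> \<open>length gs \<le> k\<close> by simp
  qed (auto simp: distrib_left intro: filt_add filt_scale ideal_subset_filt nichols_ideal_mult)
qed (auto simp: distrib_right intro: filt_add filt_scale ideal_subset_filt nichols_ideal_mult)

text \<open>A monomial of degree at most \<open>D\<close> is a generator; beyond \<open>D\<close> it
  lies in the ideal.\<close>

lemma span_lie_monomials_filt:
  assumes "f \<in> tensor_space.span {g. lie_monomial \<alpha> g}"
  shows "f \<in> filt 1"
  using assms
proof (rule tensor_space.span_induct)
  show "tensor_space.subspace {x. x \<in> filt 1}"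
    unfolding filt_def by (simp add: tensor_space.subspace_span)
  fix g assume "g \<in> {g. lie_monomial \<alpha> g}"
  then have g: "lie_monomial \<alpha> g" by simp
  show "g \<in> filt 1"
  proof (cases "total_degree \<alpha> \<le> D")
    case True
    with g have "g \<in> generators" by (auto simp: generators_def lie_monomials_def)
    then show ?thesis using prod_list_filt[of "[g]" 1] by simp
  next
    case False
    then show ?thesis
      using large_in_ideal[OF lie_monomial_closed[OF g] homogeneous_tensor_power[OF lie_monomial_homogeneous[OF g]]]
      by (simp add: ideal_subset_filt)
  qed
qed

text \<open>The subtraction truncates, so the empty list counts as reducible; the property is
  finally used for lists of length \<open>Suc k\<close>.\<close>

definition reducible :: "('n, 'a) tensor list \<Rightarrow> bool" where
  "reducible gs \<longleftrightarrow> prod_list gs \<in> filt (length gs - 1)"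

text \<open>Exchanging two neighbours costs \<open>br b a\<close>, a combination of single
  generators modulo the ideal, and hence only shorter products.\<close>

lemma reducible_swap:
  assumes gens: "set (xs @ a # b # ys) \<subseteq> generators" and red: "reducible (xs @ b # a # ys)"
  shows "reducible (xs @ a # b # ys)"
proof -
  obtain \<alpha> \<beta> where a: "lie_monomial \<alpha> a" and b: "lie_monomial \<beta> b"
    using gens by (auto simp: generators_def lie_monomials_def)
  have ab: "a * b = br b a + tscale (\<chi> \<alpha> \<beta>) (b * a)"
    using a b by (simp add: bracket_eq[of \<beta> b \<alpha> a] lie_monomial_homogeneous)
  have "br b a \<in> filt 1"
    using span_lie_monomials_filt lie_monomial_bracket_span[OF a b] .
  then have "prod_list xs * br b a * prod_list ys \<in> filt (length xs + 1 + length ys)"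
    using gens by (intro filt_mult prod_list_filt) auto
  moreover have "tscale (\<chi> \<alpha> \<beta>) (prod_list (xs @ b # a # ys)) \<in> filt (length xs + 1 + length ys)"
    using red by (intro filt_scale) (simp add: reducible_def)
  moreover have "prod_list (xs @ a # b # ys) =
      prod_list xs * br b a * prod_list ys + tscale (\<chi> \<alpha> \<beta>) (prod_list (xs @ b # a # ys))"
    using arg_cong[OF ab, of "\<lambda>z. prod_list xs * z * prod_list ys"]
    by (simp add: distrib_left distrib_right mult.assoc)
  ultimately show ?thesis
    using filt_add unfolding reducible_def by fastforce
qed

lemma reducible_move:
  "set (ps @ u # xs @ zs) \<subseteq> generators \<Longrightarrow> reducible (ps @ u # xs @ zs) \<Longrightarrow> reducible (ps @ xs @ u # zs)"
proof (induction xs arbitrary: ps)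
  case (Cons x xs)
  then have "reducible ((ps @ [x]) @ u # xs @ zs)"
    using reducible_swap[of ps x u "xs @ zs"] by simp
  then show ?case
    using Cons.IH[of "ps @ [x]"] Cons.prems(1) by simp
qed simp

text \<open>The remainder \<open>zs\<close> is chosen before the prefix \<open>ps\<close>; this
  allows the induction to append an extracted \<open>u\<close> to the prefix.\<close>

lemma reducible_gather:
  assumes "count_list xs u \<ge> n"
  shows "\<exists>zs. set zs \<subseteq> set xs \<and>
    (\<forall>ps. set ps \<subseteq> generators \<longrightarrow> set xs \<subseteq> generators \<longrightarrow>
       reducible (ps @ replicate n u @ zs) \<longrightarrow> reducible (ps @ xs))"
  using assms
proof (induction n arbitrary: xs)
  case 0
  then show ?case by (intro exI[of _ xs]) simp
next
  case (Suc n)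
  then have "u \<in> set xs" by (metis count_list_0_iff not_less_eq_eq zero_le)
  then obtain l r where xs: "xs = l @ u # r" by (meson split_list)
  with Suc.prems have "count_list (l @ r) u \<ge> n" by simp
  from Suc.IH[OF this] obtain zs where zs: "set zs \<subseteq> set (l @ r)"
    "\<And>ps. set ps \<subseteq> generators \<Longrightarrow> set (l @ r) \<subseteq> generators \<Longrightarrow>
       reducible (ps @ replicate n u @ zs) \<Longrightarrow> reducible (ps @ l @ r)"
    by blast
  have "reducible (ps @ xs)" if "set ps \<subseteq> generators" "set xs \<subseteq> generators"
    "reducible (ps @ replicate (Suc n) u @ zs)" for ps
  proof -
    have "reducible ((ps @ [u]) @ l @ r)"
      using that xs by (intro zs(2)) auto
    then show ?thesis
      using reducible_move[of ps u l r] that xs by simp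
  qed
  then show ?case
    using zs(1) xs by (intro exI[of _ zs]) auto
qed

lemma generator_power_filt:
  assumes "u \<in> generators"
  shows "\<exists>h0. \<forall>h \<ge> h0. h > 0 \<longrightarrow> u ^ h \<in> filt (h - 1)"
proof -
  obtain \<alpha> where u: "lie_monomial \<alpha> u"
    using assms by (auto simp: generators_def lie_monomials_def)
  show ?thesis
  proof (cases "\<chi> \<alpha> \<alpha> = 1")
    case True
    obtain k where k: "u ^ k \<in> \<I>"
      using lie_monomial_nilpotent[OF u True] by blast
    have "u ^ h \<in> \<I>" if "h \<ge> k" for h
    proof -
      have "u ^ h = u ^ k * u ^ (h - k)" using that by (metis le_add_diff_inverse power_add)
      then show ?thesis using nichols_ideal_mult(1)[OF k] by simp
    qed
    then show ?thesis by (intro exI[of _ k] allI impI ideal_subset_filt)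
  next
    case False
    have "br u u \<in> filt 1"
      using span_lie_monomials_filt lie_monomial_bracket_span[OF u u] .
    moreover have "br u u = tscale (1 - \<chi> \<alpha> \<alpha>) (u * u)"
      using lie_monomial_homogeneous[OF u] by (simp add: bracket_eq tscale_simps)
    ultimately have "tscale (1 - \<chi> \<alpha> \<alpha>) (u * u) \<in> filt 1" by simp
    from filt_scale[OF this, of "inverse (1 - \<chi> \<alpha> \<alpha>)"] False
    have uu: "u * u \<in> filt 1" by simp
    have "u ^ h \<in> filt (h - 1)" if "h \<ge> 2" for h
    proof -
      define n where "n = h - 2"
      then have n: "h = n + 2" using that by simp
      have "u ^ n \<in> filt n"
        using prod_list_filt[of "replicate n u" n] assms by (simp add: set_replicate_conv_if)
      from filt_mult[OF this uu] have "u ^ n * (u * u) \<in> filt (n + 1)" .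
      moreover have "u ^ h = u ^ n * (u * u)" unfolding n power_add power2_eq_square ..
      ultimately show ?thesis using n by simp
    qed
    then show ?thesis by (intro exI[of _ 2] allI impI)
  qed
qed

text \<open>By pigeonhole, a product of more than \<open>card generators * h\<close> factors
  contains some generator at least \<open>h\<close> times. Gathered in front, its power is replaced
  by shorter products.\<close>

lemma filtration_stabilizes: "\<exists>K. \<forall>k. filt k \<subseteq> filt K"
proof -
  obtain h0 where h0: "\<And>u h. u \<in> generators \<Longrightarrow> h \<ge> h0 u \<Longrightarrow> h > 0 \<Longrightarrow> u ^ h \<in> filt (h - 1)"
    using generator_power_filt by metis
  have fin: "finite generators" by (simp add: generators_def finite_lie_monomials)
  \<comment> \<open>\<open>Suc\<close> makes \<open>h\<close> positive, so that \<open>h - 1\<close>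
    is a true decrease; inserting 0 protects \<open>Max\<close> against the empty set.\<close>
  define h where "h = Suc (Max (insert 0 (h0 ` generators)))"
  have h: "u ^ h \<in> filt (h - 1)" if "u \<in> generators" for u
    using that fin by (intro h0) (auto simp: h_def le_Suc_eq)
  define K where "K = card generators * h"
  have red: "reducible xs" if xs: "set xs \<subseteq> generators" "length xs > K" for xs
  proof -
    have "\<exists>u\<in>generators. count_list xs u \<ge> h"
    proof (rule ccontr)
      assume "\<not> ?thesis"
      then have "(\<Sum>u\<in>generators. count_list xs u) \<le> (\<Sum>u\<in>generators. h)"
        by (intro sum_mono) (auto simp: not_le intro: less_imp_le)
      then show False using sum_count_set[OF xs(1) fin] xs(2) by (simp add: K_def)
    qed
    then obtain u where u: "u \<in> generators" "count_list xs u \<ge> h" by blast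
    obtain zs where zs: "set zs \<subseteq> set xs"
      "reducible ([] @ replicate h u @ zs) \<Longrightarrow> reducible ([] @ xs)"
      using reducible_gather[OF u(2)] xs(1) by (metis empty_subsetI list.set(1))
    have "u ^ h * prod_list zs \<in> filt (h - 1 + length zs)"
      using zs(1) xs(1) by (intro filt_mult h u(1) prod_list_filt) auto
    moreover have "h - 1 + length zs = length (replicate h u @ zs) - 1"
      by (simp add: h_def)
    ultimately have "reducible (replicate h u @ zs)"
      by (simp add: reducible_def)
    with zs(2) show ?thesis by simp
  qed
  have "filt k \<subseteq> filt K" for k
  proof (induction k)
    case 0
    show ?case by (rule filt_mono) simp
  next
    case (Suc k)
    show ?case
    proof (cases "Suc k \<le> K")
      case True
      then show ?thesis by (rule filt_mono)
    next
      case False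
      have "f \<in> filt k" if "f \<in> filt (Suc k)" for f
        using that
      proof (induction f rule: filt_induct)
        case zero
        show ?case by (simp add: ideal_subset_filt)
      next
        case (prod gs)
        then show ?case
          using red[of gs] False prod_list_filt[of gs k]
          by (cases "length gs = Suc k") (auto simp: reducible_def)
      qed (auto intro: filt_add filt_scale ideal_subset_filt)
      then show ?thesis using Suc.IH by blast
    qed
  qed
  then show ?thesis by blast
qed

text \<open>Generators have length at most \<open>D\<close>, so products of at most \<open>K\<close>
  of them stay within length \<open>K * D\<close>.\<close>

lemma filt_length_part:
  assumes "f \<in> filt K" "m > K * D"
  shows "length_part m f \<in> \<I>"
  using assms(1)
  proof (induction f rule: filt_induct)
    case (prod gs)
    have "\<exists>d \<le> length gs * D. prod_list gs \<in> tensor_power d"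
      using prod(1)
    proof (induction gs)
      case Nil
      have "prod_list [] \<in> tensor_power 0"
        using tensor_power_single[of "[]" 1 0] unfolding tscalar_one by simp
      then show ?case by blast
    next
      case (Cons g gs)
      obtain d where d: "d \<le> length gs * D" "prod_list gs \<in> tensor_power d"
        using Cons.IH Cons.prems by auto
      have "g \<in> lie_monomials D" using Cons.prems by (simp add: generators_def)
      then obtain \<alpha> where g: "lie_monomial \<alpha> g" "total_degree \<alpha> \<le> D"
        unfolding lie_monomials_def by blast
      have "prod_list (g # gs) \<in> tensor_power (total_degree \<alpha> + d)"
        using tensor_power_mult[OF homogeneous_tensor_power[OF lie_monomial_homogeneous[OF g(1)]] d(2)] by simp
      moreover have "total_degree \<alpha> + d \<le> length (g # gs) * D"
        using d(1) g(2) by simp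
      ultimately show ?case by blast
    qed
    then obtain d where d: "d \<le> length gs * D" "prod_list gs \<in> tensor_power d" by blast
    have "length gs * D \<le> K * D" using prod(2) by simp
    with d(1) assms(2) have "d \<noteq> m" by linarith
    then show ?case using length_part_other[OF d(2)] by simp
  next
    case (ideal f)
    then have "length_part m f \<in> symmetrizer_kernel q m" by (simp add: nichols_ideal_iff)
    then show ?case by (rule symmetrizer_kernel_in_nichols_ideal)
  next
    case (scale c f)
    then show ?case by (simp add: tscale_def length_part_scale nichols_ideal_scale)
  qed (simp_all add: length_part_add nichols_ideal_add)

lemma word_in_filt: "tword w \<in> filt (length w)"
proof -
  have gen: "tword [i] \<in> generators" for i
  proof -
    \<comment> \<open>Positivity of \<open>D\<close> is what makes the letters generators.\<close>
    have "total_degree (multidegree [i]) \<le> D" using D_pos by (simp add: total_degree_word)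
    then show ?thesis
      unfolding generators_def lie_monomials_def using letter[of i] by blast
  qed
  have eq: "(tword w :: ('n, 'a) tensor) = prod_list (map (\<lambda>i. tword [i]) w)"
  proof (induction w)
    case (Cons i w)
    have "(tword (i # w) :: ('n, 'a) tensor) = tword [i] * tword w" using tword_append[of "[i]" w] by simp
    also have "\<dots> = prod_list (map (\<lambda>i. tword [i]) (i # w))" unfolding Cons.IH by simp
    finally show ?case .
  qed (simp add: tscalar_one)
  have "set (map (\<lambda>i. tword [i]) w) \<subseteq> generators"
    using gen by auto
  then show ?thesis
    unfolding eq by (rule prod_list_filt) simp
qed

text \<open>Every word lies in the last step of the filtration, and a word is its own component at
  its length; beyond \<open>K * D\<close> this component is in the ideal.\<close>

lemma long_words_in_ideal: "\<exists>E. \<forall>w. length w > E \<longrightarrow> tword w \<in> \<I>"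
proof -
  from filtration_stabilizes obtain K where K: "\<forall>k. filt k \<subseteq> filt K" ..
  have "tword w \<in> \<I>" if len: "length w > K * D" for w
  proof -
    have "tword w \<in> filt K" using subsetD[OF spec[OF K] word_in_filt] .
    from filt_length_part[OF this len] show ?thesis by (simp add: length_part_single)
  qed
  then show ?thesis by (intro exI[of _ "K * D"] allI impI)
qed

end

section \<open>The Nichols algebra as a quotient ring\<close>

lemma tensor_algebra_simps:
  "carrier tensor_algebra = UNIV" "f \<otimes>\<^bsub>tensor_algebra\<^esub> g = f * g" "f \<oplus>\<^bsub>tensor_algebra\<^esub> g = f + g"
  "\<zero>\<^bsub>tensor_algebra\<^esub> = 0" "\<one>\<^bsub>tensor_algebra\<^esub> = 1"
  by (simp_all add: tensor_algebra_def ring_of_type_algebra_def)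

lemma ring_tensor_algebra: "ring (tensor_algebra :: ('n, 'a::field_char_0) tensor ring)"
proof (rule ringI)
  show "abelian_group (tensor_algebra :: ('n, 'a) tensor ring)"
  proof (rule abelian_groupI)
    fix f :: "('n, 'a) tensor"
    show "\<exists>g\<in>carrier tensor_algebra. g \<oplus>\<^bsub>tensor_algebra\<^esub> f = \<zero>\<^bsub>tensor_algebra\<^esub>"
      by (rule bexI[of _ "- f"]) (simp_all add: tensor_algebra_simps)
  qed (simp_all add: tensor_algebra_simps ac_simps)
  show "Group.monoid (tensor_algebra :: ('n, 'a) tensor ring)"
    by (rule monoidI) (simp_all add: tensor_algebra_simps mult.assoc)
qed (simp_all add: tensor_algebra_simps distrib_left distrib_right)

lemma tensor_algebra_uminus: "\<ominus>\<^bsub>tensor_algebra\<^esub> f = - f"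
proof -
  interpret ring "tensor_algebra :: ('a, 'b) tensor ring" by (rule ring_tensor_algebra)
  show ?thesis by (rule minus_equality) (simp_all add: tensor_algebra_simps)
qed

lemma ideal_nichols_ideal:
  fixes q :: "'n::finite \<Rightarrow> 'n \<Rightarrow> 'a::field_char_0"
  shows "ideal (nichols_ideal q) tensor_algebra"
proof (rule idealI[OF ring_tensor_algebra])
  interpret ring "tensor_algebra :: ('n, 'a) tensor ring" by (rule ring_tensor_algebra)
  show "subgroup (nichols_ideal q) (add_monoid tensor_algebra)"
    by (rule add.subgroupI)
       (auto simp: tensor_algebra_simps tensor_algebra_uminus nichols_ideal_uminus nichols_ideal_add
          intro: nichols_ideal_zero)
qed (simp_all add: tensor_algebra_simps nichols_ideal_mult)

lemma nichols_proj_ring_hom: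
  fixes q :: "'n::finite \<Rightarrow> 'n \<Rightarrow> 'a::field_char_0"
  shows "ring_hom_ring tensor_algebra (nichols_algebra q) (nichols_proj q)"
  using ideal.rcos_ring_hom_ring[OF ideal_nichols_ideal[of q]]
  by (simp add: nichols_algebra_def nichols_proj_def[abs_def])

lemma nichols_proj_eq_set: "nichols_proj q f = {h + f | h. h \<in> nichols_ideal q}"
  by (auto simp: nichols_proj_def a_r_coset_def' tensor_algebra_simps)

lemma nichols_proj_eq_iff: "nichols_proj q f = nichols_proj q g \<longleftrightarrow> f - g \<in> nichols_ideal q"
proof
  assume "nichols_proj q f = nichols_proj q g"
  moreover have "0 + f \<in> nichols_proj q f"
    unfolding nichols_proj_eq_set using nichols_ideal_zero by blast
  ultimately obtain h where "f = h + g" "h \<in> nichols_ideal q"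
    unfolding nichols_proj_eq_set by auto
  then show "f - g \<in> nichols_ideal q" by simp
next
  have *: "nichols_proj q f \<subseteq> nichols_proj q g" if "f - g \<in> nichols_ideal q" for f g
  proof
    fix x assume "x \<in> nichols_proj q f"
    then obtain h where "x = h + f" "h \<in> nichols_ideal q" by (auto simp: nichols_proj_eq_set)
    then have "x = (h + (f - g)) + g" "h + (f - g) \<in> nichols_ideal q"
      using that by (simp_all add: nichols_ideal_add)
    then show "x \<in> nichols_proj q g" unfolding nichols_proj_eq_set by blast
  qed
  assume "f - g \<in> nichols_ideal q"
  moreover from nichols_ideal_uminus[OF this] have "g - f \<in> nichols_ideal q" by simp
  ultimately show "nichols_proj q f = nichols_proj q g" using * by blast
qed

lemma carrier_nichols_algebra: "carrier (nichols_algebra q) = range (nichols_proj q)"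
  by (auto simp: nichols_algebra_def FactRing_def A_RCOSETS_def' nichols_proj_def tensor_algebra_simps a_r_coset_def')

section \<open>Subspaces of the quotient, described by representatives\<close>

context
  fixes q :: "'n::finite \<Rightarrow> 'n \<Rightarrow> 'a::field_char_0"
begin

interpretation hom: ring_hom_ring tensor_algebra "nichols_algebra q" "nichols_proj q"
  by (rule nichols_proj_ring_hom)

lemma nichols_proj_add: "nichols_proj q (f + g) = nichols_proj q f \<oplus>\<^bsub>nichols_algebra q\<^esub> nichols_proj q g"
  using hom.hom_add[of f g] by (simp add: tensor_algebra_simps)

lemma nichols_proj_mult: "nichols_proj q (f * g) = nichols_proj q f \<otimes>\<^bsub>nichols_algebra q\<^esub> nichols_proj q g"
  using hom.hom_mult[of f g] by (simp add: tensor_algebra_simps)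

lemma nichols_proj_zero: "nichols_proj q 0 = \<zero>\<^bsub>nichols_algebra q\<^esub>"
  using hom.hom_zero by (simp add: tensor_algebra_simps)

lemma nichols_proj_uminus: "nichols_proj q (- f) = \<ominus>\<^bsub>nichols_algebra q\<^esub> nichols_proj q f"
  using hom.hom_a_inv[of f] by (simp add: tensor_algebra_simps tensor_algebra_uminus)

lemma subfield_tscalar: "subfield (range tscalar) (tensor_algebra :: ('n, 'a) tensor ring)"
proof (rule hom.R.subfieldI)
  have ring: "subring (range tscalar) (tensor_algebra :: ('n, 'a) tensor ring)"
  proof (rule hom.R.subringI)
    show "\<one>\<^bsub>tensor_algebra\<^esub> \<in> range tscalar"
      using tscalar_one by (metis rangeI tensor_algebra_simps(5))
  qed (auto simp: tensor_algebra_simps tensor_algebra_uminus tscalar_mult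
        simp flip: tscalar_uminus tscalar_add)
  then show "subcring (range tscalar) (tensor_algebra :: ('n, 'a) tensor ring)"
    by (rule hom.R.subcringI) (auto simp: tensor_algebra_simps tscalar_mult mult.commute)
  let ?A = "tensor_algebra :: ('n, 'a) tensor ring"
  let ?T = "?A\<lparr>carrier := range tscalar\<rparr>"
  show "Units ?T = range tscalar - {\<zero>\<^bsub>?A\<^esub>}"
  proof -
    have unit: "tscalar c \<in> Units ?T" if "c \<noteq> 0" for c :: 'a
      using that unfolding Units_def
      by (auto simp: tensor_algebra_simps tscalar_mult tscalar_one intro!: exI[of _ "inverse c"])
    have "0 \<notin> Units ?T"
      by (auto simp: Units_def tensor_algebra_simps)
    moreover have "Units ?T \<subseteq> (range tscalar :: ('n, 'a) tensor set)"
      by (auto simp: Units_def)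
    ultimately show ?thesis
    proof (intro equalityI subsetI)
      fix x :: "('n, 'a) tensor" assume *: "x \<in> range tscalar - {\<zero>\<^bsub>?A\<^esub>}"
      then obtain c where "x = tscalar c" by blast
      moreover from this * have "c \<noteq> 0"
        by (auto simp: tensor_algebra_simps)
      ultimately show "x \<in> Units ?T" using unit by simp
    qed (auto simp: tensor_algebra_simps)
  qed
qed

lemma subfield_nichols_scalars: "subfield (nichols_scalars q) (nichols_algebra q)"
proof -
  have "nichols_proj q 1 \<noteq> nichols_proj q 0"
    using one_notin_nichols_ideal by (simp add: nichols_proj_eq_iff)
  then have "\<one>\<^bsub>nichols_algebra q\<^esub> \<noteq> \<zero>\<^bsub>nichols_algebra q\<^esub>"
    using hom.hom_one nichols_proj_zero by (simp add: tensor_algebra_simps)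
  from hom.img_is_subfield(2)[OF subfield_tscalar this] show ?thesis
    by (simp add: nichols_scalars_def image_image)
qed

lemma nichols_subalgebraI:
  assumes "V \<subseteq> range (nichols_proj q)" "nichols_proj q 0 \<in> V"
    and "\<And>f g. nichols_proj q f \<in> V \<Longrightarrow> nichols_proj q g \<in> V \<Longrightarrow> nichols_proj q (f + g) \<in> V"
    and "\<And>c f. nichols_proj q f \<in> V \<Longrightarrow> nichols_proj q (tscale c f) \<in> V"
  shows "subalgebra (nichols_scalars q) V (nichols_algebra q)"
proof (intro subalgebra.intro subalgebra_axioms.intro)
  show "subgroup V (add_monoid (nichols_algebra q))"
  proof (rule hom.S.add.subgroupI)
    show "V \<subseteq> carrier (nichols_algebra q)" using assms(1) by (simp add: carrier_nichols_algebra)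
    show "V \<noteq> {}" using assms(2) by blast
    fix A assume A: "A \<in> V"
    then obtain f where f: "A = nichols_proj q f" using assms(1) by blast
    show "\<ominus>\<^bsub>nichols_algebra q\<^esub> A \<in> V"
      using assms(4)[of f "-1"] A f by (simp add: nichols_proj_uminus)
    fix B assume B: "B \<in> V"
    then obtain g where "B = nichols_proj q g" using assms(1) by blast
    then show "A \<oplus>\<^bsub>nichols_algebra q\<^esub> B \<in> V"
      using assms(3)[of f g] A B f by (simp add: nichols_proj_add)
  qed
  fix k A assume "k \<in> nichols_scalars q" and A: "A \<in> V"
  then obtain c where "k = nichols_proj q (tscalar c)" by (auto simp: nichols_scalars_def)
  moreover obtain f where "A = nichols_proj q f" using assms(1) A by blast
  ultimately show "k \<otimes>\<^bsub>nichols_algebra q\<^esub> A \<in> V"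
    using assms(4)[of f c] A by (simp add: nichols_proj_mult tscale_def)
qed

lemma nichols_subalgebra_closed:
  assumes V: "subalgebra (nichols_scalars q) V (nichols_algebra q)"
  shows "V \<subseteq> range (nichols_proj q)" and "nichols_proj q 0 \<in> V"
    and "nichols_proj q f \<in> V \<Longrightarrow> nichols_proj q g \<in> V \<Longrightarrow> nichols_proj q (f + g) \<in> V"
    and "nichols_proj q f \<in> V \<Longrightarrow> nichols_proj q (tscale c f) \<in> V"
proof -
  interpret subalgebra "nichols_scalars q" V "nichols_algebra q" by (rule V)
  show "V \<subseteq> range (nichols_proj q)" using subset by (simp add: carrier_nichols_algebra)
  show "nichols_proj q 0 \<in> V" using one_closed by (simp add: nichols_proj_zero)
  show "nichols_proj q f \<in> V \<Longrightarrow> nichols_proj q g \<in> V \<Longrightarrow> nichols_proj q (f + g) \<in> V"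
    using m_closed by (simp add: nichols_proj_add)
  show "nichols_proj q f \<in> V \<Longrightarrow> nichols_proj q (tscale c f) \<in> V"
    using smult_closed by (simp add: nichols_proj_mult tscale_def nichols_scalars_def)
qed

lemma nichols_bracket_proj:
  "nichols_bracket q (nichols_proj q f) (nichols_proj q g) = nichols_proj q (tensor_bracket q f g)"
proof -
  have "nichols_proj q (tensor_bracket q f' g') = nichols_proj q (tensor_bracket q f g)"
    if f': "f' \<in> nichols_proj q f" and g': "g' \<in> nichols_proj q g" for f' g'
  proof -
    obtain h k where hk: "f' = h + f" "g' = k + g" "h \<in> nichols_ideal q" "k \<in> nichols_ideal q"
      using f' g' unfolding nichols_proj_eq_set by blast
    have "tensor_bracket q f' g' - tensor_bracket q f g = tensor_bracket q h g' + tensor_bracket q f k"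
      by (simp add: hk tensor_bracket_add_left tensor_bracket_add_right)
    also have "\<dots> \<in> nichols_ideal q"
      using hk by (intro nichols_ideal_add tensor_bracket_nichols_ideal)
    finally show ?thesis by (simp add: nichols_proj_eq_iff)
  qed
  then have "nichols_bracket q (nichols_proj q f) (nichols_proj q g)
      = (\<Union>f'\<in>nichols_proj q f. \<Union>g'\<in>nichols_proj q g. nichols_proj q (tensor_bracket q f g))"
    unfolding nichols_bracket_def by (intro SUP_cong refl)
  moreover have "0 + f \<in> nichols_proj q f" "0 + g \<in> nichols_proj q g"
    unfolding nichols_proj_eq_set using nichols_ideal_zero by blast+
  then have "nichols_proj q f \<noteq> {}" "nichols_proj q g \<noteq> {}"
    by (metis empty_iff)+
  ultimately show ?thesis
    by simp
qed

lemma nichols_lie_algebra_subalgebra: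
  "subalgebra (nichols_scalars q) (nichols_lie_algebra q) (nichols_algebra q)"
proof (rule nichols_subalgebraI)
  \<comment> \<open>The whole algebra belongs to the intersected family, so the intersection
    contains nothing but cosets.\<close>
  have "subalgebra (nichols_scalars q) (range (nichols_proj q)) (nichols_algebra q)"
    by (rule nichols_subalgebraI) auto
  then have "nichols_lie_algebra q \<subseteq> range (nichols_proj q)"
    unfolding nichols_lie_algebra_def by (rule_tac Inter_lower) (auto simp: nichols_bracket_proj)
  then show "nichols_lie_algebra q \<subseteq> range (nichols_proj q)" .
qed (auto simp: nichols_lie_algebra_def intro: nichols_subalgebra_closed)

lemma nichols_lie_algebra_letter: "nichols_proj q (tword [i]) \<in> nichols_lie_algebra q"
proof -
  have "tword [i] \<in> tensor_power 1" by simp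
  then show ?thesis unfolding nichols_lie_algebra_def by blast
qed

lemma nichols_lie_algebra_bracket:
  assumes "nichols_proj q f \<in> nichols_lie_algebra q" "nichols_proj q g \<in> nichols_lie_algebra q"
  shows "nichols_proj q (tensor_bracket q f g) \<in> nichols_lie_algebra q"
  unfolding nichols_lie_algebra_def
proof (rule InterI)
  fix U assume U: "U \<in> {U. subalgebra (nichols_scalars q) U (nichols_algebra q)
      \<and> nichols_proj q ` tensor_power 1 \<subseteq> U \<and> (\<forall>A\<in>U. \<forall>B\<in>U. nichols_bracket q A B \<in> U)}"
  then have "nichols_lie_algebra q \<subseteq> U"
    unfolding nichols_lie_algebra_def by (rule Inter_lower)
  with assms U have "nichols_bracket q (nichols_proj q f) (nichols_proj q g) \<in> U"
    by blast
  then show "nichols_proj q (tensor_bracket q f g) \<in> U"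
    by (simp only: nichols_bracket_proj)
qed

text \<open>Representatives of a finite spanning set involve words of length at most some
  \<open>N\<close>, so every element of \<open>V\<close> has a representative \<open>g\<close> of
  this kind. If \<open>f\<close> has length \<open>m > N\<close>, then \<open>f\<close> is the
  component of length \<open>m\<close> of \<open>f - g\<close>, and the ideal is graded.\<close>

lemma finite_dimension_length_bounded:
  assumes fd: "hom.S.finite_dimension (nichols_scalars q) V"
  shows "\<exists>N. \<forall>f m. nichols_proj q f \<in> V \<longrightarrow> f \<in> tensor_power m \<longrightarrow> m > N \<longrightarrow> f \<in> nichols_ideal q"
proof -
  obtain n where "hom.S.dimension n (nichols_scalars q) V"
    using fd by (auto simp: hom.S.finite_dimension_def)
  from hom.S.exists_base[OF subfield_nichols_scalars this] obtain Vs where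
    Vs: "set Vs \<subseteq> range (nichols_proj q)" "hom.S.Span (nichols_scalars q) Vs = V"
    unfolding carrier_nichols_algebra by blast
  define rep where "rep v = (SOME f. nichols_proj q f = v)" for v
  have rep: "nichols_proj q (rep v) = v" if "v \<in> set Vs" for v
  proof -
    have "\<exists>f. nichols_proj q f = v" using that Vs(1) by auto
    then show ?thesis unfolding rep_def by (rule someI_ex)
  qed
  define S where "S = (\<Union>v\<in>set Vs. Poly_Mapping.keys (rep v))"
  define N where "N = Max (insert 0 (length ` S))"
  have "finite S" by (simp add: S_def)
  then have N: "length w \<le> N" if "w \<in> S" for w
    using that by (simp add: N_def)
  define B where "B = {f :: ('n, 'a) tensor. \<forall>w\<in>Poly_Mapping.keys f. length w \<le> N}"
  \<comment> \<open>Components are linear in \<open>f\<close>, so closure of \<open>B\<close> under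
    sums and multiples can be read off from this form.\<close>
  have parts: "f \<in> B \<longleftrightarrow> (\<forall>m>N. length_part m f = 0)" for f
  proof
    assume f: "f \<in> B"
    show "\<forall>m>N. length_part m f = 0"
    proof (intro allI impI)
      fix m assume "m > N"
      have "length_part m f = linear_extension (\<lambda>_. 0) f"
        unfolding length_part_def
        by (rule linear_extension_cong) (use f \<open>m > N\<close> in \<open>auto simp: B_def\<close>)
      then show "length_part m f = 0" by (simp add: linear_extension_def)
    qed
  next
    assume *: "\<forall>m>N. length_part m f = 0"
    have lookup: "Poly_Mapping.lookup (length_part (length w) g) w = Poly_Mapping.lookup g w" for g :: "('n, 'a) tensor" and w
      by (induction g rule: tensor_induct) (auto simp: length_part_add lookup_add length_part_single lookup_single when_def)
    show "f \<in> B"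
      unfolding B_def mem_Collect_eq
    proof
      fix w assume "w \<in> Poly_Mapping.keys f"
      then have "length_part (length w) f \<noteq> 0"
        using lookup[of w f] by (metis in_keys_iff lookup_zero)
      then show "length w \<le> N" using * by (meson not_le)
    qed
  qed
  have "subalgebra (nichols_scalars q) (nichols_proj q ` B) (nichols_algebra q)"
  proof (rule nichols_subalgebraI)
    show "nichols_proj q 0 \<in> nichols_proj q ` B" by (auto simp: B_def)
  next
    fix f g assume "nichols_proj q f \<in> nichols_proj q ` B" "nichols_proj q g \<in> nichols_proj q ` B"
    then obtain f' g' where "nichols_proj q f = nichols_proj q f'" "nichols_proj q g = nichols_proj q g'"
      "f' \<in> B" "g' \<in> B" by blast
    then have "nichols_proj q (f + g) = nichols_proj q (f' + g')" "f' + g' \<in> B"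
      by (simp_all add: nichols_proj_add parts length_part_add)
    then show "nichols_proj q (f + g) \<in> nichols_proj q ` B" by blast
  next
    fix c f assume "nichols_proj q f \<in> nichols_proj q ` B"
    then obtain f' where "nichols_proj q f = nichols_proj q f'" "f' \<in> B" by blast
    then have "nichols_proj q (tscale c f) = nichols_proj q (tscale c f')" "tscale c f' \<in> B"
      by (simp_all add: tscale_def nichols_proj_mult parts length_part_scale)
    then show "nichols_proj q (tscale c f) \<in> nichols_proj q ` B" by blast
  qed blast
  moreover have "set Vs \<subseteq> nichols_proj q ` B"
  proof
    fix v assume v: "v \<in> set Vs"
    then have "rep v \<in> B" using N by (auto simp: B_def S_def)
    then show "v \<in> nichols_proj q ` B" using rep[OF v] by (metis imageI)
  qed
  ultimately have sub: "V \<subseteq> nichols_proj q ` B"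
    using hom.S.subalgebra_Span_incl[OF subfield_nichols_scalars, of "nichols_proj q ` B" Vs]
    unfolding Vs(2) by blast
  have "f \<in> nichols_ideal q" if f: "nichols_proj q f \<in> V" "f \<in> tensor_power m" "m > N" for f m
  proof -
    obtain g where g: "nichols_proj q f = nichols_proj q g" "g \<in> B" using sub f(1) by blast
    then have "f - g \<in> nichols_ideal q" by (simp add: nichols_proj_eq_iff)
    then have "length_part m (f - g) \<in> symmetrizer_kernel q m" by (simp add: nichols_ideal_iff)
    then have "length_part m (f - g) \<in> nichols_ideal q"
      by (rule symmetrizer_kernel_in_nichols_ideal)
    moreover have "length_part m (f - g) = f"
      using length_part_add[of m "f - g" g] g(2) f(3) length_part_same[OF f(2)] by (simp add: parts)
    ultimately show ?thesis by simp
  qed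
  then show ?thesis by (intro exI[of _ N] allI impI)
qed

lemma finite_dimension_nichols_algebra:
  assumes E: "\<And>w. length w > E \<Longrightarrow> tword w \<in> nichols_ideal q"
  shows "hom.S.finite_dimension (nichols_scalars q) (carrier (nichols_algebra q))"
proof -
  have "finite {w :: 'n list. length w \<le> E}"
    using finite_lists_length_le[of "UNIV :: 'n set" E] by simp
  then obtain ws where ws: "set ws = {w :: 'n list. length w \<le> E}"
    using finite_list by blast
  let ?Us = "map (\<lambda>w. nichols_proj q (tword w)) ws"
  have Us: "set ?Us \<subseteq> carrier (nichols_algebra q)"
    by (auto simp: carrier_nichols_algebra)
  let ?S = "hom.S.Span (nichols_scalars q) ?Us"
  have sub: "subalgebra (nichols_scalars q) ?S (nichols_algebra q)"
    by (rule hom.S.Span_is_subalgebra[OF subfield_nichols_scalars Us])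
  have "nichols_proj q f \<in> ?S" for f
  proof (induction f rule: tensor_induct)
    case zero
    show ?case by (rule nichols_subalgebra_closed(2)[OF sub])
  next
    case (add f g)
    then show ?case by (rule nichols_subalgebra_closed(3)[OF sub])
  next
    case (single w c)
    have "nichols_proj q (tword w) \<in> ?S"
    proof (cases "length w \<le> E")
      case True
      then show ?thesis
        using hom.S.Span_base_incl[OF subfield_nichols_scalars Us] ws by auto
    next
      case False
      then have "nichols_proj q (tword w) = nichols_proj q 0"
        using E[of w] by (simp add: nichols_proj_eq_iff)
      then show ?thesis using nichols_subalgebra_closed(2)[OF sub] by simp
    qed
    from nichols_subalgebra_closed(4)[OF sub this, of c] show ?case
      by (simp add: tscale_def tensor_single_mult)
  qed
  then have "carrier (nichols_algebra q) \<subseteq> ?S"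
    by (auto simp: carrier_nichols_algebra)
  moreover have "?S \<subseteq> carrier (nichols_algebra q)"
    by (rule hom.S.Span_in_carrier) (use subfieldE(3)[OF subfield_nichols_scalars] Us in auto)
  ultimately have "carrier (nichols_algebra q) = ?S" by blast
  then show ?thesis
    using hom.S.Span_finite_dimension[OF subfield_nichols_scalars Us] by metis
qed

end

theorem theorem2p2:
  fixes q :: "'n::finite \<Rightarrow> 'n \<Rightarrow> 'a::field_char_0"
  assumes "card (UNIV :: 'n set) > 1"
    and "\<forall>i j. q i j \<noteq> 0"
    and "connected_braiding q"
  shows "ring.finite_dimension (nichols_algebra q) (nichols_scalars q) (carrier (nichols_algebra q))
     \<longleftrightarrow> ring.finite_dimension (nichols_algebra q) (nichols_scalars q) (nichols_lie_algebra q)"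
proof
  interpret hom: ring_hom_ring tensor_algebra "nichols_algebra q" "nichols_proj q"
    by (rule nichols_proj_ring_hom)
  show "hom.S.finite_dimension (nichols_scalars q) (nichols_lie_algebra q)"
    if "hom.S.finite_dimension (nichols_scalars q) (carrier (nichols_algebra q))"
    using hom.S.subalbegra_incl_imp_finite_dimension[OF subfield_nichols_scalars that
        nichols_lie_algebra_subalgebra] hom.S.subalgebra_in_carrier[OF nichols_lie_algebra_subalgebra]
    by blast
  assume "hom.S.finite_dimension (nichols_scalars q) (nichols_lie_algebra q)"
  from finite_dimension_length_bounded[OF this] obtain N where
    N: "\<forall>f m. nichols_proj q f \<in> nichols_lie_algebra q \<longrightarrow> f \<in> tensor_power m \<longrightarrow> m > N
      \<longrightarrow> f \<in> nichols_ideal q" ..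
  interpret diagonal_braiding q
    using assms(2) by unfold_locales simp
  \<comment> \<open>\<open>Suc N\<close> rather than \<open>N\<close>, because the locale asks for a
    positive bound.\<close>
  interpret connected_bracket_closed q "{f. nichols_proj q f \<in> nichols_lie_algebra q}" "Suc N"
  proof (unfold_locales, goal_cases)
    case (1 i)
    have "\<exists>j. j \<noteq> i"
    proof (rule ccontr)
      assume "\<nexists>j. j \<noteq> i"
      then have "(UNIV :: 'n set) = {i}" by auto
      from arg_cong[OF this, of card] assms(1) show False by simp
    qed
    then obtain j where "j \<noteq> i" ..
    have "(i, j) \<in> (braiding_graph q)\<^sup>*"
      using assms(3) by (simp add: connected_braiding_def)
    \<comment> \<open>A path from \<open>i\<close> to a different vertex has a first edge, which
      leads to a neighbour of \<open>i\<close>.\<close>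
    then obtain k where "(i, k) \<in> braiding_graph q"
      using \<open>j \<noteq> i\<close> by (cases rule: converse_rtranclE) auto
    then have "symm_bichar (multidegree [i]) (multidegree [k]) \<noteq> 1"
      by (simp add: symm_bichar_def bicharacter_letters braiding_graph_def)
    then show ?case
      by (auto simp: radical_def)
  next
    case (2 f g)
    then show ?case using nichols_subalgebra_closed(3)[OF nichols_lie_algebra_subalgebra] by simp
  next
    case (3 f c)
    then show ?case using nichols_subalgebra_closed(4)[OF nichols_lie_algebra_subalgebra] by simp
  next
    case (4 i)
    then show ?case using nichols_lie_algebra_letter by simp
  next
    case (5 f g)
    then show ?case using nichols_lie_algebra_bracket by simp
  next
    case (6 f m)
    then show ?case using N by simp
  next
    case 7
    then show ?case by simp
  qed
  from long_words_in_ideal obtain E where "\<forall>w. length w > E \<longrightarrow> tword w \<in> nichols_ideal q" ..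
  then show "hom.S.finite_dimension (nichols_scalars q) (carrier (nichols_algebra q))"
    by (intro finite_dimension_nichols_algebra[of E]) simp
qed

end
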